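(* Consider a family, indexed by $\epsilon>0$, of $(q_\epsilon,r_\epsilon)$-extendable branching processes with offspring generating functions $f_\epsilon$, where $\epsilon=1-f_\epsilon(1)$, such that for some $s_0>1$ and some generating function $f$, $$f_\epsilon(s)\to f(s)\ \ (\epsilon\to0)\ \text{ for } s\in[0,s_0],\qquad f(1)=1,\quad f(s_0)<\infty,\quad f(s_0)\ne s_0.$$ Let $T_{1,\epsilon}$ be the termination time, and $m_1=f'(1)$. Let $\epsilon\to0$. (i) If $m_1<1$, then for any fixed $t\ge0$, $$\mathrm{P}\big(T_{1,\epsilon}\le t\,\big|\,T_{1,\epsilon}<\infty\big)\to1-e^{-(1-m_1)t}.$$ (ii) If $m_1>1$, let $q\in[0,1)$ be the smallest non-negative root of $f(x)=x$, let $\beta_\epsilon=f_\epsilon'(r_\epsilon)-1$, and let $\phi(x)=f^{(3)}(q,1,x)$, $\phi^{(2)}(1,x)=f^{(4)}(q,1,1,x)$. Then for any fixed $u\in(-\infty,\infty)$, $$\mathrm{P}\Big(T_{1,\epsilon}\le\frac{\ln (r_\epsilon-1)^{-1}}{\beta_\epsilon}+\frac{\ln(1-q)+u}{m_1-1}\,\Big|\,T_{1,\epsilon}<\infty\Big)\to\Phi(u),$$ and the limit distribution function $\Phi$ satisfies $$u=\ln\Phi(u)+\int_{1-(1-q)\Phi(u)}^1\psi(x)\,dx,$$ where the function $$\psi(x)=\frac{\phi^{(2)}(1,x)}{\phi(x)}+\frac{m_1-1}{(1-q)(x-q)\phi(x)}$$ takes positive values over $x\in(q,1]$.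
   Context: Branching process: $f(s)=\sum_{k\ge0}p_ks^k$ with $p_k\ge0$, $f(1)\le1$, $p_1\ne1$. The branching process with offspring generating function $f$ is the continuous-time Markov process $\{Z_t\}_{t\ge0}$ with $Z_0=1$: particles have independent exponential life lengths with parameter 1; at death a particle is, independently of everything else, replaced by $k$ particles with probability $p_k$, $k\ge0$, while with probability $1-f(1)$ it sends the whole process to an absorbing graveyard state $\Delta$. The termination time $T_1$ is the time of absorption at $\Delta$ ($T_1=\infty$ if this never happens); $T_{1,\epsilon}$ is the termination time of the process with offspring generating function $f_\epsilon$. The process is $(q,r)$-extendable, where $0\le q\le1\le r<\infty$, $q<r$, if $f(q)=q$ and $f(r)=r$ (with $f$ the power series). Tail generating functions: for $v(s)=\sum_{k\ge0}v_ks^k$ with all $v_k\ge0$ and $n\ge1$, $$v^{(n)}(s_1,\ldots,s_n)=\sum_{i_1\ge0,\ldots,i_n\ge0}v_{i_1+\cdots+i_n+n-1}\,s_1^{i_1}\cdots s_n^{i_n}.$$ *)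

theory Defs
  imports "HOL-Probability.Probability"
begin

definition gen_fun :: "(nat \<Rightarrow> real) \<Rightarrow> real \<Rightarrow> real" where
  "gen_fun v s = (\<Sum>k. v k * s ^ k)"

text \<open>A point \<open>x\<close> is a fixed point of \<open>gen_fun v\<close>, with the series required to converge at \<open>x\<close>
  (\<open>gen_fun\<close> alone has an unspecified value where it diverges).\<close>

definition gen_fun_fixpoint :: "(nat \<Rightarrow> real) \<Rightarrow> real \<Rightarrow> bool" where
  "gen_fun_fixpoint v x \<longleftrightarrow> (\<lambda>k. v k * x ^ k) sums x"

definition extendable :: "(nat \<Rightarrow> real) \<Rightarrow> real \<Rightarrow> real \<Rightarrow> bool" where
  "extendable p q r \<longleftrightarrow>
     0 \<le> q \<and> q \<le> 1 \<and> 1 \<le> r \<and> q < r \<and> gen_fun_fixpoint p q \<and> gen_fun_fixpoint p r"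

text \<open>The tail generating function of order \<open>n = length ss\<close>; the multi-index
  \<open>(i\<^sub>1, \<dots>, i\<^sub>n)\<close> is a list of length \<open>n\<close>.\<close>

definition tail_gen_fun :: "(nat \<Rightarrow> real) \<Rightarrow> real list \<Rightarrow> real" where
  "tail_gen_fun v ss =
     (\<Sum>\<^sub>\<infinity>is\<in>{is :: nat list. length is = length ss}.
        v (sum_list is + length ss - 1) * (\<Prod>j<length ss. (ss ! j) ^ (is ! j)))"

text \<open>Particles carry Ulam--Harris labels: the root is \<open>[]\<close> and \<open>u @ [i]\<close> is the \<open>i\<close>-th child
  of \<open>u\<close>, counting from \<open>0\<close>. The life length of \<open>u\<close> is \<open>L u\<close>; at its death \<open>u\<close> is replaced by
  \<open>k\<close> particles if \<open>N u = Some k\<close>, and sends the process to the graveyard if \<open>N u = None\<close>.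
  The parameter is the offspring distribution \<open>p\<close> (possibly defective, \<open>suminf p = gen_fun p 1\<close>).\<close>

locale branching_process = prob_space M
  for M :: "'a measure"
    and p :: "nat \<Rightarrow> real"
    and L :: "nat list \<Rightarrow> 'a \<Rightarrow> real"
    and N :: "nat list \<Rightarrow> 'a \<Rightarrow> nat option" +
  assumes offspring_nonneg: "\<And>k. 0 \<le> p k"
    and offspring_summable: "summable p"
    and offspring_le_1: "suminf p \<le> 1"
    and offspring_nontrivial: "p 1 \<noteq> 1"
    and life_exponential: "\<And>u. distributed M lborel (L u) (exponential_density 1)"
    and offspring_measurable: "\<And>u. random_variable (count_space UNIV) (N u)"
    and offspring_Some: "\<And>u k. prob {\<omega> \<in> space M. N u \<omega> = Some k} = p k"
    and offspring_None: "\<And>u. prob {\<omega> \<in> space M. N u \<omega> = None} = 1 - suminf p"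
    and life_offspring_indep:
      "\<And>u. indep_set {L u -` A \<inter> space M | A. A \<in> sets borel} {N u -` B \<inter> space M | B. B \<in> UNIV}"
    and particles_indep:
      "indep_vars (\<lambda>_. borel \<Otimes>\<^sub>M count_space UNIV) (\<lambda>u \<omega>. (L u \<omega>, N u \<omega>)) UNIV"

definition realized :: "(nat list \<Rightarrow> 'a \<Rightarrow> nat option) \<Rightarrow> nat list \<Rightarrow> 'a \<Rightarrow> bool" where
  "realized N u \<omega> \<longleftrightarrow> (\<forall>j<length u. \<exists>k. N (take j u) \<omega> = Some k \<and> u ! j < k)"

definition birth_time :: "(nat list \<Rightarrow> 'a \<Rightarrow> real) \<Rightarrow> nat list \<Rightarrow> 'a \<Rightarrow> real" where
  "birth_time L u \<omega> = (\<Sum>j<length u. L (take j u) \<omega>)"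

definition death_time :: "(nat list \<Rightarrow> 'a \<Rightarrow> real) \<Rightarrow> nat list \<Rightarrow> 'a \<Rightarrow> real" where
  "death_time L u \<omega> = birth_time L u \<omega> + L u \<omega>"

text \<open>The state at time \<open>t\<close>: \<open>None\<close> is the absorbing graveyard, \<open>Some n\<close> means \<open>n\<close> particles are
  alive (\<open>n = \<infinity>\<close> accommodates a possible explosion).\<close>

definition population ::
    "(nat list \<Rightarrow> 'a \<Rightarrow> real) \<Rightarrow> (nat list \<Rightarrow> 'a \<Rightarrow> nat option) \<Rightarrow> real \<Rightarrow> 'a \<Rightarrow> enat option" where
  "population L N t \<omega> =
     (if \<exists>u. realized N u \<omega> \<and> N u \<omega> = None \<and> death_time L u \<omega> \<le> t then None
      else let A = {u. realized N u \<omega> \<and> birth_time L u \<omega> \<le> t \<and> t < death_time L u \<omega>}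
           in Some (if finite A then enat (card A) else \<infinity>))"

definition termination_time ::
    "(nat list \<Rightarrow> 'a \<Rightarrow> real) \<Rightarrow> (nat list \<Rightarrow> 'a \<Rightarrow> nat option) \<Rightarrow> 'a \<Rightarrow> ereal" where
  "termination_time L N \<omega> = (INF t \<in> {t. 0 \<le> t \<and> population L N t \<omega> = None}. ereal t)"

end

theory Submission
  imports Defs
begin

text \<open>Conditioning on the death of the root, the probability \<open>h(t)\<close> that no graveyard jump occurs up to
  time \<open>t\<close> satisfies a renewal equation, which is equivalent to \<open>h' = f(h) - h\<close>, \<open>h(0) = 1\<close>. This
  solution decreases from \<open>1\<close> to \<open>q\<close>, so the conditional law in question is \<open>(1 - h(t)) / (1 - q)\<close>.

  In the subcritical case \<open>q\<^sub>\<epsilon> \<rightarrow> 1\<close>, and on \<open>[q\<^sub>\<epsilon>, 1]\<close> the equation becomes linear with rate \<open>m\<^sub>1 - 1\<close>.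

  In the supercritical case the solution starts close to the unstable equilibrium \<open>r\<^sub>\<epsilon>\<close>, and it reaches
  the level \<open>y\<close> at time \<open>\<integral>\<^sub>y\<^sup>1 dx / (x - f\<^sub>\<epsilon>(x))\<close>. The integrand differs from its linearization
  \<open>1 / (\<beta>\<^sub>\<epsilon> (r\<^sub>\<epsilon> - x))\<close> at \<open>r\<^sub>\<epsilon>\<close> by a uniformly bounded function that converges to
  \<open>\<psi>(x) / (m\<^sub>1 - 1)\<close>, because \<open>\<psi>(x) = (m\<^sub>1 - 1) / (x - f(x)) - 1 / (1 - x)\<close>. Dominated convergence
  gives the limiting passage times, and inverting them gives the limit law.\<close>

section \<open>Generating functions\<close>

text \<open>The laws are controlled only by pointwise limits on \<open>[0, s0]\<close>, so every
  uniform statement is extracted from convexity: series with nonnegative coefficients lie above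
  their tangents and below their chords, which locates the fixed points, and increments bound
  derivatives further left, which turns bounds at \<open>s0 > 1\<close> into uniform second
  derivative bounds around \<open>1\<close>. The supercritical obstacle is that the passage time
  diverges: the start \<open>1\<close> is at distance \<open>r_\<epsilon> - 1\<close> from a zero of
  \<open>x - f_\<epsilon>(x)\<close>, which costs a time of order
  \<open>ln (1 / (r_\<epsilon> - 1)) / \<beta>_\<epsilon>\<close>. The rate must be the exact slope
  at \<open>r_\<epsilon>\<close>; any error in replacing it by its limit would be multiplied by the
  diverging logarithm. Integrating \<open>1 / (x - f_\<epsilon>(x))\<close> along the solution
  replaces any appeal to uniqueness for the differential equation; monotonicity of \<open>h\<close>
  comes from probability.\<close>

lemma gen_fun_summable_le:
  fixes v :: "nat \<Rightarrow> real"
  assumes "\<And>k. 0 \<le> v k" "summable (\<lambda>k. v k * R ^ k)" "0 \<le> x" "x \<le> R"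
  shows "summable (\<lambda>k. v k * x ^ k)"
  by (rule summable_comparison_test'[OF assms(2), of 0])
     (use assms in \<open>auto simp: abs_mult intro!: mult_left_mono power_mono\<close>)

lemma gen_fun_mono:
  assumes "\<And>k. 0 \<le> v k" "summable (\<lambda>k. v k * y ^ k)" "0 \<le> x" "x \<le> y"
  shows "gen_fun v x \<le> gen_fun v y"
  unfolding gen_fun_def
  by (rule suminf_le) (use assms gen_fun_summable_le[OF assms] in \<open>auto intro!: mult_left_mono power_mono\<close>)

lemma gen_fun_nonneg:
  assumes "\<And>k. 0 \<le> v k" "summable (\<lambda>k. v k * x ^ k)" "0 \<le> x"
  shows "0 \<le> gen_fun v x"
  unfolding gen_fun_def by (rule suminf_nonneg) (use assms in auto)

lemma diffs_nonneg: "(\<And>k. 0 \<le> v k) \<Longrightarrow> 0 \<le> diffs v k" for v :: "nat \<Rightarrow> real"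
  by (simp add: diffs_def)

lemma diffs_summable:
  fixes v :: "nat \<Rightarrow> real"
  assumes "summable (\<lambda>k. v k * R ^ k)" "0 \<le> x" "x < R"
  shows "summable (\<lambda>k. diffs v k * x ^ k)"
  by (rule termdiff_converges[of _ R])
     (use assms in \<open>auto intro: powser_inside[OF assms(1)]\<close>)

lemma gen_fun_DERIV:
  assumes "summable (\<lambda>k. v k * R ^ k)" "0 \<le> x" "x < R"
  shows "(gen_fun v has_real_derivative gen_fun (diffs v) x) (at x)"
  using termdiffs_strong[OF assms(1), of x] assms unfolding gen_fun_def by simp

lemma gen_fun_MVT:
  assumes "\<And>k. 0 \<le> v k" "summable (\<lambda>k. v k * R ^ k)" "0 \<le> x" "x < y" "y < R"
  obtains z where "x < z" "z < y" "gen_fun v y - gen_fun v x = (y - x) * gen_fun (diffs v) z"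
  using MVT2[of x y "gen_fun v" "gen_fun (diffs v)"] gen_fun_DERIV[OF assms(2)] assms by fastforce

text \<open>The derivative series also has nonnegative coefficients, so it is nondecreasing and the
  slope at the mean value point lies between those at the two ends.\<close>

lemma gen_fun_diff_bounds:
  assumes "\<And>k. 0 \<le> v k" "summable (\<lambda>k. v k * R ^ k)" "0 \<le> x" "x \<le> y" "y < R"
  shows "(y - x) * gen_fun (diffs v) x \<le> gen_fun v y - gen_fun v x"
    and "gen_fun v y - gen_fun v x \<le> (y - x) * gen_fun (diffs v) y"
proof -
  have "(y - x) * gen_fun (diffs v) x \<le> gen_fun v y - gen_fun v x \<and>
    gen_fun v y - gen_fun v x \<le> (y - x) * gen_fun (diffs v) y"
  proof (cases "x = y")
    case False
    then obtain z where z: "x < z" "z < y" "gen_fun v y - gen_fun v x = (y - x) * gen_fun (diffs v) z"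
      using gen_fun_MVT[OF assms(1,2,3), of y] assms by auto
    have "gen_fun (diffs v) x \<le> gen_fun (diffs v) z" "gen_fun (diffs v) z \<le> gen_fun (diffs v) y"
      using z assms by (auto intro!: gen_fun_mono diffs_nonneg diffs_summable[OF assms(2)])
    then show ?thesis using z by (auto intro!: mult_left_mono)
  qed simp
  then show "(y - x) * gen_fun (diffs v) x \<le> gen_fun v y - gen_fun v x"
    and "gen_fun v y - gen_fun v x \<le> (y - x) * gen_fun (diffs v) y" by auto
qed

text \<open>Convexity, with \<open>y = R\<close> allowed: an offspring series is only known to
  converge at \<open>r\<close>, possibly on the boundary of its disc.\<close>

lemma gen_fun_tangent:
  assumes "\<And>k. 0 \<le> v k" "summable (\<lambda>k. v k * R ^ k)" "0 \<le> x" "x < R" "0 \<le> y" "y \<le> R"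
  shows "gen_fun v x + (y - x) * gen_fun (diffs v) x \<le> gen_fun v y"
proof (cases "x \<le> y")
  case True
  show ?thesis
  proof (cases "y < R")
    case True
    then show ?thesis using gen_fun_diff_bounds(1)[OF assms(1,2,3) \<open>x \<le> y\<close>] assms by simp
  next
    case False
    then have y: "y = R" using assms by simp
    \<comment> \<open>\<open>gen_fun v\<close> need not be differentiable at \<open>R\<close>, so
      the inequality is passed to the limit from the left; monotonicity stands in for continuity at
      \<open>R\<close>.\<close>
    have "((\<lambda>w. gen_fun v x + (w - x) * gen_fun (diffs v) x) \<longlongrightarrow> gen_fun v x + (y - x) * gen_fun (diffs v) x) (at_left y)"
      by (intro tendsto_intros)
    moreover have "eventually (\<lambda>w. gen_fun v x + (w - x) * gen_fun (diffs v) x \<le> gen_fun v y) (at_left y)"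
      using eventually_at_left_real[OF assms(4)] unfolding y
    proof eventually_elim
      case (elim w)
      then show ?case
        using gen_fun_diff_bounds(1)[OF assms(1,2,3), of w] gen_fun_mono[OF assms(1,2), of w] assms by auto
    qed
    ultimately show ?thesis by (rule tendsto_upperbound) simp
  qed
next
  case False
  then show ?thesis using gen_fun_diff_bounds(2)[OF assms(1,2,5), of x] assms by (simp add: algebra_simps)
qed

text \<open>A Cauchy-type estimate: the increment over \<open>[x, y]\<close> dominates
  \<open>y - x\<close> times the slope at \<open>x\<close> and is itself at most the value at
  \<open>R\<close>.\<close>

lemma gen_fun_diffs_le:
  assumes "\<And>k. 0 \<le> v k" "summable (\<lambda>k. v k * R ^ k)" "0 \<le> x" "x < y" "y < R"
  shows "gen_fun (diffs v) x \<le> gen_fun v R / (y - x)"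
proof -
  have "(y - x) * gen_fun (diffs v) x \<le> gen_fun v y - gen_fun v x"
    using gen_fun_diff_bounds(1)[OF assms(1-3)] assms by simp
  also have "\<dots> \<le> gen_fun v R"
    using gen_fun_nonneg[OF assms(1) gen_fun_summable_le[OF assms(1,2)], of x]
      gen_fun_mono[OF assms(1,2), of y] assms by simp
  finally show ?thesis using assms by (simp add: field_simps)
qed

lemma gen_fun_continuous_on:
  assumes "summable (\<lambda>k. v k * R ^ k)" "S \<subseteq> {0..<R}"
  shows "continuous_on S (gen_fun v)"
  using gen_fun_DERIV[OF assms(1)] assms(2)
  by (meson DERIV_isCont atLeastLessThan_iff continuous_at_imp_continuous_on subsetD)

text \<open>Averaging the two inequalities for the tangent at the convex combination cancels the
  slope terms.\<close>

lemma gen_fun_minus_id_convex: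
  assumes "\<And>k. 0 \<le> v k" "summable (\<lambda>k. v k * R ^ k)" "0 \<le> x" "x \<le> R" "0 \<le> y" "y \<le> R"
    "0 \<le> a" "0 \<le> b" "a + b = 1" "a * x + b * y < R"
  shows "gen_fun v (a * x + b * y) - (a * x + b * y) \<le> a * (gen_fun v x - x) + b * (gen_fun v y - y)"
proof -
  let ?z = "a * x + b * y"
  have z: "0 \<le> ?z" "?z < R" using assms by auto
  have 1: "a * (gen_fun v ?z + (x - ?z) * gen_fun (diffs v) ?z) \<le> a * gen_fun v x"
    by (intro mult_left_mono gen_fun_tangent[OF assms(1,2) z]) (use assms in auto)
  have 2: "b * (gen_fun v ?z + (y - ?z) * gen_fun (diffs v) ?z) \<le> b * gen_fun v y"
    by (intro mult_left_mono gen_fun_tangent[OF assms(1,2) z]) (use assms in auto)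
  have "a * (gen_fun v ?z + (x - ?z) * gen_fun (diffs v) ?z) + b * (gen_fun v ?z + (y - ?z) * gen_fun (diffs v) ?z)
     = (a + b) * gen_fun v ?z + (a * x + b * y - (a + b) * ?z) * gen_fun (diffs v) ?z" by algebra
  also have "\<dots> = gen_fun v ?z" using assms(9) by simp
  finally show ?thesis using 1 2 by (simp add: algebra_simps)
qed

text \<open>Convexity in the form in which it is applied: signs at two points decide the sign at a
  third. The case \<open>z = y\<close> is separate because \<open>y\<close> may be \<open>R\<close>,
  where no tangent is available.\<close>

lemma gen_fun_chord:
  assumes "\<And>k. 0 \<le> v k" "summable (\<lambda>k. v k * R ^ k)" "0 \<le> x" "x \<le> z" "z \<le> y" "x < y" "y \<le> R"
  shows "(y - x) * (gen_fun v z - z) \<le> (y - z) * (gen_fun v x - x) + (z - x) * (gen_fun v y - y)"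
proof (cases "z = y")
  case False
  define a b where "a = (y - z) / (y - x)" and "b = (z - x) / (y - x)"
  have ab: "a + b = 1" "a \<ge> 0" "b \<ge> 0" using assms
    by (auto simp: a_def b_def add_divide_distrib[symmetric])
  have y: "y - x \<noteq> 0" using assms by simp
  have z: "a * x + b * y = z"
  proof -
    have "(y - z) * x + (z - x) * y = z * (y - x)" by algebra
    then show ?thesis unfolding a_def b_def using y
      by (simp add: add_divide_distrib[symmetric])
  qed
  have "gen_fun v z - z \<le> a * (gen_fun v x - x) + b * (gen_fun v y - y)"
    using gen_fun_minus_id_convex[OF assms(1,2), of x y a b] ab assms z False by simp
  then have "(y - x) * (gen_fun v z - z) \<le> (y - x) * (a * (gen_fun v x - x) + b * (gen_fun v y - y))"
    using assms by (intro mult_left_mono) auto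
  also have "\<dots> = ((y - x) * a) * (gen_fun v x - x) + ((y - x) * b) * (gen_fun v y - y)"
    by (simp add: algebra_simps)
  also have "\<dots> = (y - z) * (gen_fun v x - x) + (z - x) * (gen_fun v y - y)"
    using y by (simp add: a_def b_def)
  finally show ?thesis .
qed simp

lemma gen_fun_fixpoint_eq: "gen_fun_fixpoint v x \<longleftrightarrow> summable (\<lambda>k. v k * x ^ k) \<and> gen_fun v x = x"
  unfolding gen_fun_fixpoint_def gen_fun_def by (metis sums_iff)

text \<open>The chord of \<open>gen_fun v x - x\<close> over \<open>[q, 1]\<close> starts at
  \<open>0\<close> and ends at a negative value.\<close>

lemma gen_fun_less_id_left:
  assumes v: "\<And>k. 0 \<le> v k" "summable (\<lambda>k. v k * R ^ k)" and "1 < R" "gen_fun v 1 < 1"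
    and "0 \<le> q" "gen_fun v q = q" "q < x" "x \<le> 1"
  shows "gen_fun v x < x"
proof -
  have "(1 - q) * (gen_fun v x - x) \<le> (x - q) * (gen_fun v 1 - 1)"
    using gen_fun_chord[OF v, of q x 1] assms by simp
  also have "\<dots> < 0" using assms by (simp add: mult_less_0_iff)
  finally show ?thesis using assms by (simp add: mult_less_0_iff)
qed

text \<open>The mirror image, with the chord over \<open>[1, r]\<close>. Here \<open>R\<close> may
  be \<open>r\<close> itself, so convergence beyond \<open>r\<close> is not assumed.\<close>

lemma gen_fun_less_id_right:
  assumes v: "\<And>k. 0 \<le> v k" "summable (\<lambda>k. v k * R ^ k)" and "r \<le> R" "gen_fun v 1 < 1"
    and "gen_fun v r = r" "1 \<le> x" "x < r"
  shows "gen_fun v x < x"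
proof -
  have "(r - 1) * (gen_fun v x - x) \<le> (r - x) * (gen_fun v 1 - 1)"
    using gen_fun_chord[OF v, of 1 x r] assms by simp
  also have "\<dots> < 0" using assms by (simp add: mult_less_0_iff)
  finally show ?thesis using assms by (simp add: mult_less_0_iff)
qed

section \<open>Tail generating functions\<close>

text \<open>The shift \<open>m\<close> is decoupled from the number of variables: fixing the
  exponent \<open>i\<close> of one variable turns \<open>m\<close> into \<open>m + i\<close>, so a
  recursion on the list leaves the family with \<open>m = length ss - 1\<close>.\<close>

definition tail_sum :: "nat \<Rightarrow> (nat \<Rightarrow> real) \<Rightarrow> real list \<Rightarrow> real" where
  "tail_sum m v ss =
     (\<Sum>\<^sub>\<infinity>is\<in>{is :: nat list. length is = length ss}.
        v (sum_list is + m) * (\<Prod>j<length ss. (ss ! j) ^ (is ! j)))"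

lemma tail_gen_fun_eq_tail_sum: "ss \<noteq> [] \<Longrightarrow> tail_gen_fun v ss = tail_sum (length ss - 1) v ss"
  unfolding tail_gen_fun_def tail_sum_def
  by (intro infsum_cong) (simp add: Suc_le_eq)

lemma bij_betw_Cons:
  "bij_betw (\<lambda>(i, is). i # is) (UNIV \<times> {is. length is = n}) {is. length is = Suc n}"
  by (rule bij_betwI[where g = "\<lambda>is. (hd is, tl is)"]) (auto simp: length_Suc_conv)

lemma monomials_summable_on:
  fixes ss :: "real list"
  assumes "\<And>s. s \<in> set ss \<Longrightarrow> 0 \<le> s \<and> s < 1"
  shows "(\<lambda>is. \<Prod>j<length ss. (ss ! j) ^ (is ! j)) summable_on {is :: nat list. length is = length ss}"
  using assms
proof (induction ss)
  case Nil
  then show ?case by simp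
next
  case (Cons s ss)
  let ?A = "{is :: nat list. length is = length ss}"
  let ?W = "\<lambda>is. \<Prod>j<length ss. (ss ! j) ^ (is ! j)"
  have W: "(?W has_sum infsum ?W ?A) ?A" using Cons by (intro has_sum_infsum) auto
  have s: "0 \<le> s" "s < 1" using Cons.prems by auto
  have nth: "0 \<le> ss ! j" if "j < length ss" for j using Cons.prems that nth_mem by force
  have "(\<lambda>(i, is). s ^ i * ?W is) summable_on (UNIV \<times> ?A)"
  proof (rule summable_on_SigmaI)
    show "((\<lambda>is. (case (i, is) of (i, is) \<Rightarrow> s ^ i * ?W is)) has_sum s ^ i * infsum ?W ?A) ?A" for i
      using has_sum_cmult_right[OF W] by simp
    show "(\<lambda>i. s ^ i * infsum ?W ?A) summable_on UNIV"
      using s by (intro summable_on_cmult_left norm_summable_imp_summable_on) (auto intro!: summable_geometric)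
    show "0 \<le> (case (i, is) of (i, is) \<Rightarrow> s ^ i * ?W is)" if "is \<in> ?A" for i "is"
      using s nth by (auto intro!: prod_nonneg mult_nonneg_nonneg)
  qed
  then have "(\<lambda>x. (\<lambda>is. \<Prod>j<length (s # ss). ((s # ss) ! j) ^ (is ! j)) ((\<lambda>(i, is). i # is) x))
      summable_on (UNIV \<times> ?A)"
    by (rule back_subst[where P = "\<lambda>f. f summable_on _"])
       (auto simp: prod.lessThan_Suc_shift simp del: prod.lessThan_Suc)
  then have "(\<lambda>is. \<Prod>j<length (s # ss). ((s # ss) ! j) ^ (is ! j)) summable_on {is. length is = Suc (length ss)}"
    by (rule summable_on_reindex_bij_betw[OF bij_betw_Cons, THEN iffD1])
  then show ?case by (simp del: prod.lessThan_Suc)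
qed

text \<open>The numbers \<open>v k * R ^ k\<close> are bounded, so the terms are dominated by a
  constant times a product of geometric series with ratios \<open>s / R\<close>.\<close>

lemma tail_sum_summable_on:
  fixes v :: "nat \<Rightarrow> real"
  assumes v: "\<And>k. 0 \<le> v k" "summable (\<lambda>k. v k * R ^ k)" and "0 < R"
    and ss: "\<And>s. s \<in> set ss \<Longrightarrow> 0 \<le> s \<and> s < R"
  shows "(\<lambda>is. v (sum_list is + m) * (\<Prod>j<length ss. (ss ! j) ^ (is ! j)))
    summable_on {is :: nat list. length is = length ss}"
proof -
  obtain C where C: "\<And>k. v k * R ^ k \<le> C"
    using convergent_imp_Bseq[OF convergentI[OF summable_LIMSEQ_zero[OF v(2)]]]
    unfolding Bseq_def by (metis abs_le_D1 real_norm_def)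
  have R: "R ^ sum_list is = (\<Prod>j<length is. R ^ (is ! j))" for "is" :: "nat list"
    by (simp add: power_sum sum_list_sum_nth atLeast0LessThan)
  let ?W = "\<lambda>is. \<Prod>j<length (map (\<lambda>s. s / R) ss). (map (\<lambda>s. s / R) ss ! j) ^ (is ! j)"
  have "(\<lambda>is. C / R ^ m * ?W is) summable_on {is. length is = length (map (\<lambda>s. s / R) ss)}"
    by (intro summable_on_cmult_right monomials_summable_on) (use ss \<open>0 < R\<close> in auto)
  then have sm: "(\<lambda>is. C / R ^ m * ?W is) summable_on {is. length is = length ss}" by simp
  show ?thesis
  proof (rule summable_on_comparison_test[OF sm])
    fix "is" :: "nat list" assume "is \<in> {is. length is = length ss}"
    then have len: "length is = length ss" by simp
    have W: "?W is = (\<Prod>j<length ss. (ss ! j) ^ (is ! j)) / R ^ sum_list is"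
      unfolding R using len by (simp add: power_divide prod_dividef)
    have "0 \<le> (\<Prod>j<length ss. (ss ! j) ^ (is ! j))"
      using ss by (intro prod_nonneg) auto
    moreover have "v (sum_list is + m) \<le> C / R ^ m / R ^ sum_list is"
      using C[of "sum_list is + m"] \<open>0 < R\<close> by (simp add: field_simps power_add)
    ultimately show "v (sum_list is + m) * (\<Prod>j<length ss. (ss ! j) ^ (is ! j)) \<le> C / R ^ m * ?W is"
      unfolding W using mult_right_mono by fastforce
    show "0 \<le> v (sum_list is + m) * (\<Prod>j<length ss. (ss ! j) ^ (is ! j))"
      using v ss by (auto intro!: mult_nonneg_nonneg prod_nonneg)
  qed
qed

lemma tail_sum_nonneg:
  assumes "\<And>k. 0 \<le> v k" "\<And>s. s \<in> set ss \<Longrightarrow> 0 \<le> s"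
  shows "0 \<le> tail_sum m v ss"
  unfolding tail_sum_def using assms by (auto intro!: infsum_nonneg mult_nonneg_nonneg prod_nonneg)

lemma tail_sum_Nil [simp]: "tail_sum m v [] = v m"
  by (simp add: tail_sum_def)

text \<open>Fubini over the first exponent: a tail sum becomes a power series in its first variable,
  to which the results on \<open>gen_fun\<close> apply.\<close>

lemma tail_sum_Cons:
  assumes v: "\<And>k. 0 \<le> v k" "summable (\<lambda>k. v k * R ^ k)" and R: "0 < R"
    and ss: "\<And>t. t \<in> set (s # ss) \<Longrightarrow> 0 \<le> t \<and> t < R"
  shows "(\<lambda>i. tail_sum (m + i) v ss * s ^ i) sums tail_sum m v (s # ss)"
proof -
  let ?A = "{is :: nat list. length is = length ss}"
  let ?F = "\<lambda>is. v (sum_list is + m) * (\<Prod>j<length (s # ss). ((s # ss) ! j) ^ (is ! j))"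
  have F: "?F ((\<lambda>(i, is). i # is) (i, is))
      = (v (sum_list is + (m + i)) * (\<Prod>j<length ss. (ss ! j) ^ (is ! j))) * s ^ i" for i "is"
    by (auto simp: prod.lessThan_Suc_shift ac_simps simp del: prod.lessThan_Suc)
  have sm: "(\<lambda>x. ?F ((\<lambda>(i, is). i # is) x)) summable_on UNIV \<times> ?A"
    using tail_sum_summable_on[OF v R, of "s # ss" m] ss
    by (subst summable_on_reindex_bij_betw[OF bij_betw_Cons]) (simp del: prod.lessThan_Suc)
  have *: "infsum (\<lambda>is. ?F ((\<lambda>(i, is). i # is) (i, is))) ?A = tail_sum (m + i) v ss * s ^ i" for i
    unfolding F tail_sum_def by (rule infsum_cmult_left')
  have "infsum (\<lambda>x. ?F ((\<lambda>(i, is). i # is) x)) (UNIV \<times> ?A) = infsum ?F {is. length is = Suc (length ss)}"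
    by (rule infsum_reindex_bij_betw[OF bij_betw_Cons])
  then have "infsum (\<lambda>i. infsum (\<lambda>is. ?F ((\<lambda>(i, is). i # is) (i, is))) ?A) UNIV = tail_sum m v (s # ss)"
    unfolding infsum_Sigma_banach[OF sm] tail_sum_def by (simp del: prod.lessThan_Suc)
  moreover have "(\<lambda>i. infsum (\<lambda>is. ?F ((\<lambda>(i, is). i # is) (i, is))) ?A) summable_on UNIV"
    using summable_on_Sigma_banach[of "\<lambda>i is. ?F ((\<lambda>(i, is). i # is) (i, is))" UNIV "\<lambda>_. ?A"] sm
    by (simp add: case_prod_beta')
  ultimately have "((\<lambda>i. tail_sum (m + i) v ss * s ^ i) has_sum tail_sum m v (s # ss)) UNIV"
    unfolding * by (metis has_sum_infsum)
  then show ?thesis by (rule has_sum_imp_sums)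
qed

lemma tail_sum_Cons_gen_fun:
  assumes "\<And>k. 0 \<le> v k" "summable (\<lambda>k. v k * R ^ k)" "0 < R"
    "\<And>t. t \<in> set (s # ss) \<Longrightarrow> 0 \<le> t \<and> t < R"
  shows "tail_sum m v (s # ss) = gen_fun (\<lambda>i. tail_sum (m + i) v ss) s"
  using tail_sum_Cons[OF assms] by (simp add: gen_fun_def sums_iff)

lemma tail_sum_singleton: "tail_sum 0 v [s] = gen_fun v s"
  if "\<And>k. 0 \<le> v k" "summable (\<lambda>k. v k * R ^ k)" "0 \<le> s" "s < R"
proof -
  have "tail_sum 0 v [s] = gen_fun (\<lambda>i. tail_sum (0 + i) v []) s"
    by (rule tail_sum_Cons_gen_fun[OF that(1,2)]) (use that in auto)
  then show ?thesis by simp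
qed

text \<open>Lifts a permutation of the later variables past the head, since
  \<open>tail_sum_swap\<close> exchanges only the two foremost ones.\<close>

lemma tail_sum_Cons_cong:
  assumes "\<And>k. 0 \<le> v k" "summable (\<lambda>k. v k * R ^ k)" "0 < R"
    "\<And>t. t \<in> set (s # ss) \<Longrightarrow> 0 \<le> t \<and> t < R" "\<And>m. tail_sum m v ss = tail_sum m v ss'" "set ss = set ss'"
  shows "tail_sum m v (s # ss) = tail_sum m v (s # ss')"
proof -
  have "(\<lambda>i. tail_sum (m + i) v ss * s ^ i) sums tail_sum m v (s # ss)"
    by (rule tail_sum_Cons[OF assms(1-4)])
  moreover have "(\<lambda>i. tail_sum (m + i) v ss' * s ^ i) sums tail_sum m v (s # ss')"
    by (rule tail_sum_Cons[OF assms(1-3)]) (use assms(4,6) in auto)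
  ultimately show ?thesis using assms(5) by (auto intro: sums_unique2)
qed

lemma tail_sum_swap: "tail_sum m v (a # b # ss) = tail_sum m v (b # a # ss)"
proof -
  let ?g = "\<lambda>is :: nat list. (is ! 1) # (is ! 0) # drop 2 is"
  have "bij_betw ?g {is. length is = length (b # a # ss)} {is. length is = length (a # b # ss)}"
    by (rule bij_betwI[where g = ?g]) (auto simp: length_Suc_conv)
  then have "tail_sum m v (a # b # ss) = (\<Sum>\<^sub>\<infinity>is\<in>{is. length is = length (b # a # ss)}.
      v (sum_list (?g is) + m) * (\<Prod>j<length (a # b # ss). ((a # b # ss) ! j) ^ (?g is ! j)))"
    unfolding tail_sum_def
    by (rule infsum_reindex_bij_betw[symmetric])
  also have "\<dots> = tail_sum m v (b # a # ss)"
    unfolding tail_sum_def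
    by (intro infsum_cong)
       (auto simp: length_Suc_conv prod.lessThan_Suc_shift ac_simps simp del: prod.lessThan_Suc)
  finally show ?thesis .
qed

text \<open>Splitting off the terms with first exponent \<open>0\<close> on either side of \<open>tail_sum_swap\<close> shows that
  tail generating functions are iterated divided differences.\<close>

lemma tail_sum_divided_difference:
  assumes v: "\<And>k. 0 \<le> v k" "summable (\<lambda>k. v k * R ^ k)" and R: "0 < R"
    and ss: "\<And>s. s \<in> set (a # b # ss) \<Longrightarrow> 0 \<le> s \<and> s < R"
  shows "(a - b) * tail_sum (Suc m) v (a # b # ss) = tail_sum m v (a # ss) - tail_sum m v (b # ss)"
proof -
  have split: "tail_sum m v (a # ss) = tail_sum m v ss + a * tail_sum (Suc m) v (a # ss)"
    if "\<And>s. s \<in> set (a # ss) \<Longrightarrow> 0 \<le> s \<and> s < R" for a m ss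
  proof -
    have "(\<lambda>i. a * (tail_sum (Suc m + i) v ss * a ^ i)) sums (a * tail_sum (Suc m) v (a # ss))"
      using tail_sum_Cons[OF v R that, where m = "Suc m"] by (rule sums_mult)
    then have "(\<lambda>i. tail_sum (m + Suc i) v ss * a ^ Suc i) sums (a * tail_sum (Suc m) v (a # ss))"
      by (simp add: ac_simps)
    from sums_Suc[OF this] show ?thesis
      using tail_sum_Cons[OF v R that, where m = m] by (simp add: sums_iff)
  qed
  have "tail_sum m v (a # b # ss) = tail_sum m v (b # ss) + a * tail_sum (Suc m) v (a # b # ss)"
    by (rule split) (use ss in auto)
  moreover have "tail_sum m v (b # a # ss) = tail_sum m v (a # ss) + b * tail_sum (Suc m) v (b # a # ss)"
    by (rule split) (use ss in auto)
  ultimately show ?thesis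
    by (simp add: tail_sum_swap[of _ v b a] algebra_simps)
qed

lemma tail_sum_Cons_continuous_on:
  assumes v: "\<And>k. 0 \<le> v k" "summable (\<lambda>k. v k * R ^ k)"
    and S: "0 < S" "S < R" and ss: "\<And>s. s \<in> set ss \<Longrightarrow> 0 \<le> s \<and> s < R"
  shows "continuous_on {0..<S} (\<lambda>x. tail_sum m v (x # ss))"
proof -
  have "summable (\<lambda>i. tail_sum (m + i) v ss * S ^ i)"
    by (rule sums_summable[OF tail_sum_Cons[OF v]]) (use ss S in auto)
  then have "continuous_on {0..<S} (gen_fun (\<lambda>i. tail_sum (m + i) v ss))"
    by (rule gen_fun_continuous_on) simp
  then show ?thesis
    by (rule continuous_on_eq)
       (use S ss in \<open>auto intro!: tail_sum_Cons_gen_fun[OF v, symmetric]\<close>)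
qed

text \<open>The confluent divided difference: the difference quotients at \<open>1\<close> are tail
  sums at \<open>[x, 1]\<close>, which are continuous in \<open>x\<close>.\<close>

lemma tail_sum_1_1:
  assumes v: "\<And>k. 0 \<le> v k" "summable (\<lambda>k. v k * R ^ k)" and R: "1 < R"
  shows "tail_sum 1 v [1, 1] = gen_fun (diffs v) 1"
proof -
  obtain S where S: "1 < S" "S < R" using dense[OF R] by auto
  have c: "continuous_on {0<..<S} (\<lambda>x. tail_sum 1 v [x, 1])"
    by (rule continuous_on_subset[OF tail_sum_Cons_continuous_on[OF v, of S]]) (use R S in auto)
  have "isCont (\<lambda>x. tail_sum 1 v [x, 1]) 1"
    by (rule continuous_on_interior[OF c]) (use S in \<open>auto simp: interior_open\<close>)
  then have "(\<lambda>x. tail_sum 1 v [x, 1]) \<midarrow>1\<rightarrow> tail_sum 1 v [1, 1]" by (simp add: isCont_def)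
  moreover have "eventually (\<lambda>x. x \<in> {0<..<R}) (at (1::real))"
    using R by (intro eventually_at_in_open') auto
  then have "eventually (\<lambda>x. tail_sum 1 v [x, 1] = (gen_fun v x - gen_fun v 1) / (x - 1)) (at 1)"
    using eventually_neq_at_within[of 1 1 UNIV]
  proof eventually_elim
    case (elim x)
    have "(x - 1) * tail_sum (Suc 0) v [x, 1] = tail_sum 0 v [x] - tail_sum 0 v [1]"
      by (rule tail_sum_divided_difference[OF v]) (use elim R in auto)
    then show ?case using elim R tail_sum_singleton[OF v, of x] tail_sum_singleton[OF v, of 1]
      by (simp add: field_simps)
  qed
  ultimately have "(\<lambda>x. (gen_fun v x - gen_fun v 1) / (x - 1)) \<midarrow>1\<rightarrow> tail_sum 1 v [1, 1]"
    by (rule Lim_transform_eventually)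
  moreover have "(\<lambda>x. (gen_fun v x - gen_fun v 1) / (x - 1)) \<midarrow>1\<rightarrow> gen_fun (diffs v) 1"
    using gen_fun_DERIV[OF v(2), of 1] R by (simp add: has_field_derivative_iff)
  ultimately show ?thesis by (rule LIM_unique)
qed

section \<open>Factorization of \<open>f(x) - x\<close> at the fixed points \<open>q\<close> and
  \<open>1\<close>\<close>

context
  fixes v :: "nat \<Rightarrow> real" and R q :: real
  assumes v: "\<And>k. 0 \<le> v k" "summable (\<lambda>k. v k * R ^ k)" and R: "1 < R"
    and v1: "gen_fun v 1 = 1" and q: "0 \<le> q" "q < 1" "gen_fun v q = q"
begin

lemma tail_sum_y_1:
  assumes "0 \<le> y" "y \<le> 1"
  shows "(y - 1) * tail_sum 1 v [y, 1] = gen_fun v y - 1"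
proof -
  have "(y - 1) * tail_sum (Suc 0) v [y, 1] = tail_sum 0 v [y] - tail_sum 0 v [1]"
    by (rule tail_sum_divided_difference[OF v]) (use R assms in auto)
  then show ?thesis using assms R by (simp add: tail_sum_singleton[OF v] v1)
qed

lemma tail_sum_q_1: "tail_sum 1 v [q, 1] = 1"
  using tail_sum_y_1[of q] q by simp

text \<open>With \<open>x\<close> in front the expression is both a power series in \<open>x\<close>
  and a divided difference between \<open>x\<close> and \<open>q\<close>.\<close>

lemma tail_gen_fun_q_1_x:
  assumes "0 \<le> x" "x \<le> 1"
  shows "tail_gen_fun v [q, 1, x] = tail_sum 2 v [x, q, 1]"
proof -
  have "tail_sum m v [q, 1, x] = tail_sum m v [q, x, 1]" for m
    by (rule tail_sum_Cons_cong[OF v]) (use R q assms in \<open>auto simp: tail_sum_swap\<close>)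
  then show ?thesis
    by (simp add: tail_gen_fun_eq_tail_sum tail_sum_swap[of _ _ x] eval_nat_numeral)
qed

lemma tail_gen_fun_q_1_1_x:
  assumes "0 \<le> x" "x \<le> 1"
  shows "tail_gen_fun v [q, 1, 1, x] = tail_sum 3 v [x, 1, q, 1]"
proof -
  have "tail_sum m v [1, 1, x] = tail_sum m v [1, x, 1]" for m
    by (rule tail_sum_Cons_cong[OF v]) (use R q assms in \<open>auto simp: tail_sum_swap\<close>)
  then have "tail_sum m v [q, 1, 1, x] = tail_sum m v [q, x, 1, 1]" for m
    by (intro tail_sum_Cons_cong[OF v]) (use R q assms in \<open>auto simp: tail_sum_swap[of _ _ 1 x]\<close>)
  moreover have "tail_sum m v [x, q, 1, 1] = tail_sum m v [x, 1, q, 1]" for m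
    by (intro tail_sum_Cons_cong[OF v]) (use R q assms in \<open>auto simp: tail_sum_swap[of _ _ 1 q]\<close>)
  ultimately show ?thesis
    by (simp add: tail_gen_fun_eq_tail_sum tail_sum_swap[of _ _ x] eval_nat_numeral)
qed

text \<open>\<open>tail_sum 1 v [x, 1]\<close> is the slope of the chord from \<open>x\<close> to
  \<open>1\<close>, and it equals \<open>1\<close> at \<open>x = q\<close> because both ends are
  fixed points. One more divided difference splits off the factor \<open>x - q\<close>.\<close>

lemma phi_factorization:
  assumes "0 \<le> x" "x \<le> 1"
  shows "(x - 1) * (x - q) * tail_gen_fun v [q, 1, x] = gen_fun v x - x"
proof -
  have 1: "(x - q) * tail_sum (Suc 1) v [x, q, 1] = tail_sum 1 v [x, 1] - tail_sum 1 v [q, 1]"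
    by (rule tail_sum_divided_difference[OF v]) (use q assms R in auto)
  have "(x - 1) * (x - q) * tail_gen_fun v [q, 1, x] = (x - 1) * ((x - q) * tail_sum (Suc 1) v [x, q, 1])"
    using tail_gen_fun_q_1_x[OF assms] by (simp add: eval_nat_numeral)
  also have "\<dots> = (x - 1) * tail_sum 1 v [x, 1] - (x - 1) * tail_sum 1 v [q, 1]"
    unfolding 1 by (simp add: algebra_simps)
  finally show ?thesis using tail_sum_y_1[OF assms] tail_sum_q_1 by simp
qed

lemma phi_1: "(1 - q) * tail_gen_fun v [q, 1, 1] = gen_fun (diffs v) 1 - 1"
proof -
  have "(1 - q) * tail_sum (Suc 1) v [1, q, 1] = tail_sum 1 v [1, 1] - tail_sum 1 v [q, 1]"
    by (rule tail_sum_divided_difference[OF v]) (use q R in auto)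
  then show ?thesis
    using tail_gen_fun_q_1_x[of 1] tail_sum_1_1[OF v R] tail_sum_q_1 by (simp add: eval_nat_numeral)
qed

lemma phi2_difference:
  assumes "0 \<le> x" "x \<le> 1"
  shows "(x - 1) * tail_gen_fun v [q, 1, 1, x] = tail_gen_fun v [q, 1, x] - tail_gen_fun v [q, 1, 1]"
proof -
  have "(x - 1) * tail_sum (Suc 2) v [x, 1, q, 1] = tail_sum 2 v [x, q, 1] - tail_sum 2 v [1, q, 1]"
    by (rule tail_sum_divided_difference[OF v]) (use R q assms in auto)
  then show ?thesis using assms by (simp add: tail_gen_fun_q_1_1_x tail_gen_fun_q_1_x eval_nat_numeral)
qed

lemma phi2_nonneg: "0 \<le> x \<Longrightarrow> 0 \<le> tail_gen_fun v [q, 1, 1, x]"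
  using q v by (subst tail_gen_fun_eq_tail_sum) (auto intro!: tail_sum_nonneg)

lemma phi_le:
  assumes "0 \<le> x" "x \<le> 1"
  shows "tail_gen_fun v [q, 1, x] \<le> tail_gen_fun v [q, 1, 1]"
  using phi2_difference[OF assms] phi2_nonneg[of x] assms mult_nonneg_nonneg[of "1 - x" "tail_gen_fun v [q, 1, 1, x]"]
  by (simp add: algebra_simps)

text \<open>A zero at a positive \<open>x\<close> forces all the nonnegative coefficients to vanish,
  hence also the value at \<open>1\<close>, against \<open>phi_1\<close>.\<close>

lemma phi_pos:
  assumes "0 < x" "x \<le> 1" "1 < gen_fun (diffs v) 1"
  shows "0 < tail_gen_fun v [q, 1, x]"
proof (rule ccontr)
  assume "\<not> ?thesis"
  moreover have nn: "0 \<le> tail_sum m v [q, 1]" for m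
    using q v by (intro tail_sum_nonneg) auto
  moreover have sms: "(\<lambda>i. tail_sum (2 + i) v [q, 1] * y ^ i) sums tail_gen_fun v [q, 1, y]" if "0 < y" "y \<le> 1" for y
    unfolding tail_gen_fun_q_1_x[OF less_imp_le[OF that(1)] that(2)]
    by (rule tail_sum_Cons[OF v]) (use that q R in auto)
  moreover have "0 \<le> tail_gen_fun v [q, 1, x]"
    using q v assms by (subst tail_gen_fun_eq_tail_sum) (auto intro!: tail_sum_nonneg)
  ultimately have "(\<lambda>i. tail_sum (2 + i) v [q, 1] * x ^ i) sums 0" using assms by (metis order_antisym not_le)
  then have "tail_sum (2 + i) v [q, 1] * x ^ i = 0" for i
    using suminf_eq_zero_iff[of "\<lambda>i. tail_sum (2 + i) v [q, 1] * x ^ i"] nn assms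
    by (auto simp: sums_iff)
  then have "tail_gen_fun v [q, 1, 1] = 0"
    using sms[of 1] assms by (simp add: sums_iff)
  with phi_1 assms(3) show False by simp
qed

lemma phi_continuous_on: "continuous_on {0..1} (\<lambda>x. tail_gen_fun v [q, 1, x])"
proof -
  obtain S where S: "1 < S" "S < R" using dense[OF R] by auto
  have "continuous_on {0..1} (\<lambda>x. tail_sum 2 v [x, q, 1])"
    by (rule continuous_on_subset[OF tail_sum_Cons_continuous_on[OF v, of S]]) (use R S q in auto)
  then show ?thesis by (rule continuous_on_eq) (simp add: tail_gen_fun_q_1_x)
qed

lemma phi2_continuous_on: "continuous_on {0..1} (\<lambda>x. tail_gen_fun v [q, 1, 1, x])"
proof -
  obtain S where S: "1 < S" "S < R" using dense[OF R] by auto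
  have "continuous_on {0..1} (\<lambda>x. tail_sum 3 v [x, 1, q, 1])"
    by (rule continuous_on_subset[OF tail_sum_Cons_continuous_on[OF v, of S]]) (use R S q in auto)
  then show ?thesis by (rule continuous_on_eq) (simp add: tail_gen_fun_q_1_1_x)
qed

end

section \<open>The termination time of a branching process\<close>

abbreviation mark_space :: "(real \<times> nat option) measure" where
  "mark_space \<equiv> borel \<Otimes>\<^sub>M count_space UNIV"

abbreviation field_space :: "(nat list \<Rightarrow> real \<times> nat option) measure" where
  "field_space \<equiv> PiM UNIV (\<lambda>_. mark_space)"

text \<open>A sample point is encoded by its tree of marks \<open>x\<close>: the particle \<open>u\<close> has life length \<open>fst (x u)\<close>
  and offspring \<open>snd (x u)\<close>.\<close>

definition safe :: "real \<Rightarrow> (nat list \<Rightarrow> real \<times> nat option) \<Rightarrow> bool" where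
  "safe t x \<longleftrightarrow> (\<forall>u. realized (\<lambda>u x. snd (x u)) u x \<longrightarrow> snd (x u) = None \<longrightarrow>
     t < death_time (\<lambda>u x. fst (x u)) u x)"

lemma safe_field:
  "safe t (\<lambda>u. (L u \<omega>, N u \<omega>)) \<longleftrightarrow>
    \<not> (\<exists>u. realized N u \<omega> \<and> N u \<omega> = None \<and> death_time L u \<omega> \<le> t)"
proof -
  have "realized (\<lambda>u x. snd (x u)) u (\<lambda>u. (L u \<omega>, N u \<omega>)) = realized N u \<omega>" for u
    by (simp add: realized_def)
  moreover have "death_time (\<lambda>u x. fst (x u)) u (\<lambda>u. (L u \<omega>, N u \<omega>)) = death_time L u \<omega>" for u
    by (simp add: death_time_def birth_time_def)
  ultimately show ?thesis unfolding safe_def by (auto simp flip: not_less)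
qed

lemma realized_Nil [simp]: "realized N [] \<omega>"
  by (simp add: realized_def)

lemma realized_Cons:
  "realized N (i # u) \<omega> \<longleftrightarrow> (\<exists>k. N [] \<omega> = Some k \<and> i < k) \<and> realized (\<lambda>u. N (i # u)) u \<omega>"
  by (simp add: realized_def All_less_Suc2)

lemma death_time_Nil [simp]: "death_time L [] \<omega> = L [] \<omega>"
  by (simp add: death_time_def birth_time_def)

lemma death_time_Cons: "death_time L (i # u) \<omega> = L [] \<omega> + death_time (\<lambda>u. L (i # u)) u \<omega>"
  by (simp add: death_time_def birth_time_def sum.lessThan_Suc_shift del: sum.lessThan_Suc)

text \<open>The branching property on a single tree: children start afresh at the death of the root
  with the remaining time \<open>t - fst (x [])\<close>, which may be negative.\<close>

lemma safe_rec:
  "safe t x \<longleftrightarrow> (case snd (x []) of None \<Rightarrow> t < fst (x [])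
     | Some k \<Rightarrow> \<forall>i<k. safe (t - fst (x [])) (\<lambda>u. x (i # u)))"
proof -
  have *: "(\<forall>u. P u) \<longleftrightarrow> P [] \<and> (\<forall>i u. P (i # u))" for P :: "nat list \<Rightarrow> bool"
    by (metis list.exhaust)
  have 1: "realized (\<lambda>u x. snd (x (i # u))) u x = realized (\<lambda>u x. snd (x u)) u (\<lambda>u. x (i # u))" for i u
    by (simp add: realized_def)
  have 2: "death_time (\<lambda>u x. fst (x (i # u))) u x = death_time (\<lambda>u x. fst (x u)) u (\<lambda>u. x (i # u))" for i u
    by (simp add: death_time_def birth_time_def)
  show ?thesis
    unfolding safe_def
    by (subst *) (auto simp: realized_Cons death_time_Cons 1 2 diff_less_eq add.commute split: option.split)
qed

lemma safe_antimono: "s \<le> t \<Longrightarrow> safe t x \<Longrightarrow> safe s x"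
  unfolding safe_def by (meson le_less_trans)

text \<open>Joint measurability in time and tree is wanted because the time remaining after the
  death of the root is random.\<close>

lemma safe_measurable: "Measurable.pred (borel \<Otimes>\<^sub>M field_space) (\<lambda>(t, x). safe t x)"
proof -
  have 1: "(\<lambda>z. fst (snd z u)) \<in> borel_measurable (borel \<Otimes>\<^sub>M field_space)" for u :: "nat list"
    by measurable
  have 2: "(\<lambda>z. snd (snd z u)) \<in> measurable (borel \<Otimes>\<^sub>M field_space) (count_space UNIV)" for u :: "nat list"
    by measurable
  have "(\<lambda>z. case z of (t, x) \<Rightarrow> safe t x) = (\<lambda>z. \<forall>u. (\<forall>j\<in>{..<length u}. \<exists>k. snd (snd z (take j u)) = Some k \<and> u ! j < k) \<longrightarrow>
     snd (snd z u) = None \<longrightarrow> fst z < (\<Sum>j<length u. fst (snd z (take j u))) + fst (snd z u))"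
    by (auto simp: safe_def realized_def death_time_def birth_time_def fun_eq_iff)
  also have "Measurable.pred (borel \<Otimes>\<^sub>M field_space) \<dots>"
    using 1 2 by measurable
  finally show ?thesis .
qed

lemma safe_measurable' [measurable]: "Measurable.pred field_space (safe t)"
  using measurable_compose[OF measurable_Pair1' safe_measurable, of t] by simp

text \<open>Independence enters as an equality of laws, so that one form serves both for life length
  against offspring of a particle and for the root against all other labels.\<close>

lemma (in prob_space) nn_integral_indep_pair:
  assumes X [measurable]: "X \<in> measurable M S" and Y [measurable]: "Y \<in> measurable M T"
    and d: "distr M S X \<Otimes>\<^sub>M distr M T Y = distr M (S \<Otimes>\<^sub>M T) (\<lambda>\<omega>. (X \<omega>, Y \<omega>))"
    and F [measurable]: "F \<in> borel_measurable (S \<Otimes>\<^sub>M T)"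
  shows "(\<integral>\<^sup>+\<omega>. F (X \<omega>, Y \<omega>) \<partial>M) = (\<integral>\<^sup>+\<omega>. (\<integral>\<^sup>+\<omega>'. F (X \<omega>, Y \<omega>') \<partial>M) \<partial>M)"
proof -
  interpret T: prob_space "distr M T Y" by (rule prob_space_distr) simp
  have F': "F \<in> borel_measurable (distr M S X \<Otimes>\<^sub>M distr M T Y)" unfolding d using F by simp
  have "(\<integral>\<^sup>+\<omega>. F (X \<omega>, Y \<omega>) \<partial>M) = (\<integral>\<^sup>+z. F z \<partial>(distr M S X \<Otimes>\<^sub>M distr M T Y))"
    unfolding d by (rule nn_integral_distr[symmetric]) simp_all
  also have "\<dots> = (\<integral>\<^sup>+x. (\<integral>\<^sup>+y. F (x, y) \<partial>distr M T Y) \<partial>distr M S X)"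
    by (rule T.nn_integral_fst[symmetric, OF F'])
  also have "\<dots> = (\<integral>\<^sup>+\<omega>. (\<integral>\<^sup>+y. F (X \<omega>, y) \<partial>distr M T Y) \<partial>M)"
    by (rule nn_integral_distr[OF X]) (use T.borel_measurable_nn_integral_fst[OF F'] in simp)
  also have "\<dots> = (\<integral>\<^sup>+\<omega>. (\<integral>\<^sup>+\<omega>'. F (X \<omega>, Y \<omega>') \<partial>M) \<partial>M)"
    by (intro nn_integral_cong nn_integral_distr)
       (auto intro!: measurable_compose[OF measurable_Pair1' F] dest: measurable_space[OF X])
  finally show ?thesis .
qed

section \<open>Laws of the marks and independence of subtrees\<close>

context branching_process
begin

definition mark :: "nat list \<Rightarrow> 'a \<Rightarrow> real \<times> nat option" where
  "mark u \<omega> = (L u \<omega>, N u \<omega>)"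

text \<open>The function \<open>h\<close> of the overview, defined for all real \<open>t\<close>
  because the renewal argument evaluates it at \<open>t - l\<close>.\<close>

definition non_absorption :: "real \<Rightarrow> real" where
  "non_absorption t = prob {\<omega> \<in> space M. safe t (\<lambda>u. mark u \<omega>)}"

lemma L_measurable [measurable]: "L u \<in> borel_measurable M"
  using life_exponential[of u] by (simp add: distributed_def)

lemma N_measurable [measurable]: "N u \<in> measurable M (count_space UNIV)"
  by (rule offspring_measurable)

lemma mark_measurable [measurable]: "mark u \<in> measurable M mark_space"
  unfolding mark_def by measurable

lemma marks_indep: "indep_vars (\<lambda>_. mark_space) mark UNIV"
  using particles_indep unfolding mark_def[abs_def] .

lemma distr_L_N:
  "distr M borel (L u) \<Otimes>\<^sub>M distr M (count_space UNIV) (N u) = distr M mark_space (mark u)"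
proof (rule pair_measure_eqI)
  interpret L: prob_space "distr M borel (L u)" by (rule prob_space_distr) simp
  interpret N: prob_space "distr M (count_space UNIV) (N u)" by (rule prob_space_distr) simp
  show "sigma_finite_measure (distr M borel (L u))" "sigma_finite_measure (distr M (count_space UNIV) (N u))"
    by unfold_locales
  show "sets (distr M borel (L u) \<Otimes>\<^sub>M distr M (count_space UNIV) (N u)) = sets (distr M mark_space (mark u))"
    by (simp add: sets_pair_measure_cong[OF sets_distr sets_distr])
  fix A B assume "A \<in> sets (distr M borel (L u))" "B \<in> sets (distr M (count_space UNIV) (N u))"
  then have A: "A \<in> sets borel" by simp
  have "prob ((L u -` A \<inter> space M) \<inter> (N u -` B \<inter> space M)) = prob (L u -` A \<inter> space M) * prob (N u -` B \<inter> space M)"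
  proof -
    have all: "\<forall>a\<in>{L u -` A \<inter> space M | A. A \<in> sets borel}. \<forall>b\<in>{N u -` B \<inter> space M | B. B \<in> UNIV}.
        prob (a \<inter> b) = prob a * prob b"
      using life_offspring_indep[of u] unfolding indep_sets2_eq by (elim conjE)
    have 1: "L u -` A \<inter> space M \<in> {L u -` A \<inter> space M | A. A \<in> sets borel}" using A by auto
    have 2: "N u -` B \<inter> space M \<in> {N u -` B \<inter> space M | B. B \<in> UNIV}" by auto
    show ?thesis by (rule bspec[OF bspec[OF all 1] 2])
  qed
  moreover have "mark u -` (A \<times> B) \<inter> space M = (L u -` A \<inter> space M) \<inter> (N u -` B \<inter> space M)"
    by (auto simp: mark_def)
  ultimately show "emeasure (distr M borel (L u)) A * emeasure (distr M (count_space UNIV) (N u)) B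
      = emeasure (distr M mark_space (mark u)) (A \<times> B)"
    using A by (simp add: emeasure_distr emeasure_eq_measure ennreal_mult)
qed

lemma nn_integral_N:
  "(\<integral>\<^sup>+\<omega>. g (N u \<omega>) \<partial>M) = ennreal (1 - suminf p) * g None + (\<Sum>k. ennreal (p k) * g (Some k))"
proof -
  have "g (N u \<omega>) = g None * indicator {\<omega>\<in>space M. N u \<omega> = None} \<omega> +
      (\<Sum>k. g (Some k) * indicator {\<omega>\<in>space M. N u \<omega> = Some k} \<omega>)" if "\<omega> \<in> space M" for \<omega>
  proof (cases "N u \<omega>")
    case None
    then show ?thesis using that by (simp add: indicator_def)
  next
    case (Some k)
    then have "(\<lambda>j. g (Some j) * indicator {\<omega>\<in>space M. N u \<omega> = Some j} \<omega>) = (\<lambda>j. if j = k then g (Some k) else 0)"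
      using that by (auto simp: indicator_def fun_eq_iff)
    moreover have "(\<Sum>j. if j = k then g (Some k) else 0) = g (Some k)"
      using sums_If_finite_set[of "{k}" "\<lambda>_. g (Some k)"] by (simp add: sums_iff)
    ultimately show ?thesis using that Some by (simp add: indicator_def)
  qed
  then have "(\<integral>\<^sup>+\<omega>. g (N u \<omega>) \<partial>M) = (\<integral>\<^sup>+\<omega>. g None * indicator {\<omega>\<in>space M. N u \<omega> = None} \<omega> +
      (\<Sum>k. g (Some k) * indicator {\<omega>\<in>space M. N u \<omega> = Some k} \<omega>) \<partial>M)"
    by (rule nn_integral_cong)
  also have "\<dots> = g None * emeasure M {\<omega>\<in>space M. N u \<omega> = None} +
      (\<Sum>k. g (Some k) * emeasure M {\<omega>\<in>space M. N u \<omega> = Some k})"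
    by (simp add: nn_integral_add nn_integral_suminf nn_integral_cmult_indicator)
  finally show ?thesis
    by (simp add: emeasure_eq_measure offspring_None offspring_Some mult.commute)
qed

lemma distr_N: "distr M (count_space UNIV) (N u) = distr M (count_space UNIV) (N v)"
proof (rule measure_eqI)
  fix A :: "nat option set"
  have "emeasure (distr M (count_space UNIV) (N w)) A = (\<integral>\<^sup>+\<omega>. indicator A (N w \<omega>) \<partial>M)" for w
  proof -
    have "emeasure (distr M (count_space UNIV) (N w)) A = (\<integral>\<^sup>+k. indicator A k \<partial>distr M (count_space UNIV) (N w))"
      by simp
    also have "\<dots> = (\<integral>\<^sup>+\<omega>. indicator A (N w \<omega>) \<partial>M)" by (rule nn_integral_distr) simp_all
    finally show ?thesis .
  qed
  then show "emeasure (distr M (count_space UNIV) (N u)) A = emeasure (distr M (count_space UNIV) (N v)) A"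
    by (simp add: nn_integral_N)
qed simp

lemma distr_mark: "distr M mark_space (mark u) = distr M mark_space (mark v)"
proof -
  have "distr M borel (L u) = distr M borel (L v)"
    using life_exponential[of u] life_exponential[of v] by (simp add: distributed_def cong: distr_cong)
  then show ?thesis unfolding distr_L_N[symmetric] distr_N[of u v] by simp
qed

lemma marks_shift_indep: "indep_vars (\<lambda>_. mark_space) (\<lambda>u. mark (v @ u)) UNIV"
proof -
  have "indep_vars (\<lambda>u. PiM {v @ u} (\<lambda>_. mark_space)) (\<lambda>u \<omega>. restrict (\<lambda>i. mark i \<omega>) {v @ u}) UNIV"
    by (rule indep_vars_restrict[OF marks_indep]) (auto simp: disjoint_family_on_def)
  then have "indep_vars (\<lambda>_. mark_space) (\<lambda>u \<omega>. (restrict (\<lambda>i. mark i \<omega>) {v @ u}) (v @ u)) UNIV"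
    by (rule indep_vars_compose2) measurable
  then show ?thesis by simp
qed

text \<open>Both laws are products with the same marginals, so every subtree is a copy in law of the
  whole tree.\<close>

lemma distr_marks_shift: "distr M field_space (\<lambda>\<omega> u. mark (v @ u) \<omega>) = distr M field_space (\<lambda>\<omega> u. mark u \<omega>)"
proof -
  have *: "distr M field_space (\<lambda>\<omega> u. mark (v @ u) \<omega>) = (\<Pi>\<^sub>M u\<in>UNIV. distr M mark_space (mark (v @ u)))" for v
    using indep_vars_iff_distr_eq_PiM[where I = UNIV and M' = "\<lambda>_. mark_space" and X = "\<lambda>u. mark (v @ u)"]
      marks_shift_indep[of v]
    by (simp add: restrict_UNIV)
  have "(\<lambda>u. distr M mark_space (mark (v @ u))) = (\<lambda>u. distr M mark_space (mark u))"
    by (rule ext) (rule distr_mark)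
  then show ?thesis using *[of v] *[of "[]"] by simp
qed

lemma marks_measurable [measurable]: "(\<lambda>\<omega> u. mark (g u) \<omega>) \<in> measurable M field_space"
  by (rule measurable_PiM_single') (auto simp: space_pair_measure)

lemma safe_events [measurable]: "{\<omega> \<in> space M. safe t (\<lambda>u. mark (g u) \<omega>)} \<in> events"
  using measurable_compose[OF marks_measurable safe_measurable'] by simp

lemma non_absorption_shift:
  "prob {\<omega> \<in> space M. safe t (\<lambda>u. mark (v @ u) \<omega>)} = non_absorption t"
proof -
  have "prob {\<omega> \<in> space M. safe t (\<lambda>u. mark (v @ u) \<omega>)}
      = measure (distr M field_space (\<lambda>\<omega> u. mark (v @ u) \<omega>)) {x \<in> space field_space. safe t x}" for v
  proof -
    have "{x \<in> space field_space. safe t x} \<in> sets field_space"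
      using safe_measurable'[of t] by (simp only: pred_def)
    then show ?thesis
      by (subst measure_distr) (auto intro!: arg_cong[where f = prob] simp: space_PiM space_pair_measure)
  qed
  from this[of v] this[of "[]"] show ?thesis
    unfolding non_absorption_def distr_marks_shift by simp
qed

text \<open>Sibling subtrees read marks on disjoint sets of labels, hence are independent. The
  childless case is separate because the product rule for independent families wants a nonempty
  index set.\<close>

lemma non_absorption_subtrees:
  "prob {\<omega> \<in> space M. \<forall>i<k. safe t (\<lambda>u. mark (v @ i # u) \<omega>)} = non_absorption t ^ k"
proof (cases "k = 0")
  case True
  then show ?thesis by (simp add: prob_space)
next
  case False
  define K where "K = (\<lambda>i :: nat. range (\<lambda>u. v @ i # u))"
  define Y where "Y = (\<lambda>i \<omega>. restrict (\<lambda>u. mark u \<omega>) (K i))"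
  define A where "A = (\<lambda>i. {y \<in> space (PiM (K i) (\<lambda>_. mark_space)). safe t (\<lambda>u. y (v @ i # u))})"
  have "indep_vars (\<lambda>i. PiM (K i) (\<lambda>_. mark_space)) Y UNIV"
    unfolding Y_def by (rule indep_vars_restrict[OF marks_indep]) (auto simp: disjoint_family_on_def K_def)
  moreover have "A i \<in> sets (PiM (K i) (\<lambda>_. mark_space))" for i
  proof -
    have "(\<lambda>y u. y (v @ i # u)) \<in> measurable (PiM (K i) (\<lambda>_. mark_space)) field_space"
      by (rule measurable_PiM_single') (auto simp: K_def space_pair_measure)
    from measurable_compose[OF this safe_measurable'] show ?thesis
      unfolding A_def by simp
  qed
  ultimately have "prob (\<Inter>i\<in>{..<k}. Y i -` A i \<inter> space M) = (\<Prod>i<k. prob (Y i -` A i \<inter> space M))"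
    using False by (intro indep_varsD) auto
  moreover have "Y i -` A i \<inter> space M = {\<omega> \<in> space M. safe t (\<lambda>u. mark ((v @ [i]) @ u) \<omega>)}" for i
    by (auto simp: A_def Y_def K_def space_PiM space_pair_measure)
  moreover from this False have "(\<Inter>i\<in>{..<k}. Y i -` A i \<inter> space M) = {\<omega> \<in> space M. \<forall>i<k. safe t (\<lambda>u. mark (v @ i # u) \<omega>)}"
    by auto
  ultimately show ?thesis
    by (simp only: non_absorption_shift prod_constant card_lessThan)
qed

lemma non_absorption_mono: "s \<le> t \<Longrightarrow> non_absorption t \<le> non_absorption s"
  unfolding non_absorption_def by (intro finite_measure_mono) (auto intro: safe_antimono safe_events)

lemma non_absorption_bounds: "0 \<le> non_absorption t" "non_absorption t \<le> 1"
  by (auto simp: non_absorption_def)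

lemma non_absorption_measurable [measurable]: "non_absorption \<in> borel_measurable borel"
proof -
  have "mono (\<lambda>t. - non_absorption t)" by (intro monoI) (simp add: non_absorption_mono)
  then have "(\<lambda>t. - (- non_absorption t)) \<in> borel_measurable borel"
    by (intro borel_measurable_uminus borel_measurable_mono)
  then show ?thesis by simp
qed

text \<open>Life lengths are nonnegative only almost surely. This value covers a root that dies
  after time \<open>t\<close> in the renewal formula.\<close>

lemma non_absorption_neg:
  assumes "t < 0"
  shows "non_absorption t = 1"
proof -
  have "AE \<omega> in M. 0 \<le> L u \<omega>" for u
  proof -
    have "prob {\<omega> \<in> space M. L u \<omega> \<le> 0} = 0"
      using exponential_distributedD_le[OF life_exponential, of 0] by simp
    then show ?thesis by (auto intro!: AE_I[where N = "{\<omega> \<in> space M. L u \<omega> \<le> 0}"] simp: emeasure_eq_measure)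
  qed
  then have "AE \<omega> in M. \<forall>u. 0 \<le> L u \<omega>" by (simp add: AE_all_countable)
  then have "AE \<omega> in M. safe t (\<lambda>u. mark u \<omega>)"
  proof (rule AE_mp, intro AE_I2 impI)
    fix \<omega> assume "\<forall>u. 0 \<le> L u \<omega>"
    then have "0 \<le> death_time L u \<omega>" for u
      by (auto simp: death_time_def birth_time_def intro!: add_nonneg_nonneg sum_nonneg)
    with assms show "safe t (\<lambda>u. mark u \<omega>)"
      unfolding mark_def safe_field by (meson le_less_trans not_less)
  qed
  then show ?thesis unfolding non_absorption_def using safe_events by (subst prob_Collect_eq_1) auto
qed

section \<open>The renewal equation\<close>

lemma emeasure_safe_given_root:
  "emeasure M {\<omega> \<in> space M. case k of None \<Rightarrow> t < l | Some k \<Rightarrow> \<forall>i<k. safe (t - l) (\<lambda>u. mark (i # u) \<omega>)}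
    = (case k of None \<Rightarrow> indicator {t<..} l | Some k \<Rightarrow> ennreal (non_absorption (t - l) ^ k))"
  using non_absorption_subtrees[of _ "t - l" "[]"]
  by (cases k) (auto simp: emeasure_eq_measure prob_space split: split_indicator)

text \<open>The root mark is independent of all other marks, so the event in \<open>safe_rec\<close>
  can be evaluated with the root mark frozen; its \<open>k\<close> subtrees then contribute a
  \<open>k\<close>-th power.\<close>

lemma non_absorption_root:
  "ennreal (non_absorption t) = (\<integral>\<^sup>+\<omega>. (case N [] \<omega> of None \<Rightarrow> indicator {t<..} (L [] \<omega>)
     | Some k \<Rightarrow> ennreal (non_absorption (t - L [] \<omega>) ^ k)) \<partial>M)"
proof -
  define B where "B = UNIV - {[] :: nat list}"
  define Y0 where "Y0 = (\<lambda>\<omega>. restrict (\<lambda>u. mark u \<omega>) {[]})"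
  define Y1 where "Y1 = (\<lambda>\<omega>. restrict (\<lambda>u. mark u \<omega>) B)"
  let ?S0 = "PiM {[]} (\<lambda>_. mark_space)" and ?S1 = "PiM B (\<lambda>_. mark_space)"
  let ?E = "\<lambda>(y0 :: nat list \<Rightarrow> real \<times> nat option, y1). case snd (y0 []) of None \<Rightarrow> t < fst (y0 [])
      | Some k \<Rightarrow> \<forall>i<k. safe (t - fst (y0 [])) (\<lambda>u. y1 (i # u))"
  have "indep_var ?S0 Y0 ?S1 Y1"
    unfolding Y0_def Y1_def by (rule indep_var_restrict[OF marks_indep]) (auto simp: B_def)
  then have Y0 [measurable]: "Y0 \<in> measurable M ?S0" and Y1 [measurable]: "Y1 \<in> measurable M ?S1"
    and d: "distr M ?S0 Y0 \<Otimes>\<^sub>M distr M ?S1 Y1 = distr M (?S0 \<Otimes>\<^sub>M ?S1) (\<lambda>\<omega>. (Y0 \<omega>, Y1 \<omega>))"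
    by (auto simp: indep_var_distribution_eq)
  have E [measurable]: "Measurable.pred (?S0 \<Otimes>\<^sub>M ?S1) ?E"
  proof -
    have root: "(\<lambda>z. fst z []) \<in> measurable (?S0 \<Otimes>\<^sub>M ?S1) mark_space"
      by (rule measurable_compose[OF measurable_fst measurable_component_singleton]) simp
    have 1 [measurable]: "(\<lambda>z. fst (fst z [])) \<in> borel_measurable (?S0 \<Otimes>\<^sub>M ?S1)"
      by (rule measurable_compose[OF root measurable_fst])
    have 2 [measurable]: "(\<lambda>z. snd (fst z [])) \<in> measurable (?S0 \<Otimes>\<^sub>M ?S1) (count_space UNIV)"
      by (rule measurable_compose[OF root measurable_snd])
    have comp: "(\<lambda>z. snd z (i # u)) \<in> measurable (?S0 \<Otimes>\<^sub>M ?S1) mark_space" for i u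
      by (rule measurable_compose[OF measurable_snd measurable_component_singleton]) (simp add: B_def)
    have "(\<lambda>z u. snd z (i # u)) \<in> measurable (?S0 \<Otimes>\<^sub>M ?S1) field_space" for i
      by (rule measurable_PiM_single') (use comp in \<open>auto simp: space_pair_measure\<close>)
    then have "(\<lambda>z. (t - fst (fst z []), \<lambda>u. snd z (i # u))) \<in> measurable (?S0 \<Otimes>\<^sub>M ?S1) (borel \<Otimes>\<^sub>M field_space)" for i
      using 1 by (intro measurable_Pair) auto
    from measurable_compose[OF this safe_measurable]
    have 3 [measurable]: "Measurable.pred (?S0 \<Otimes>\<^sub>M ?S1) (\<lambda>z. safe (t - fst (fst z [])) (\<lambda>u. snd z (i # u)))" for i
      by simp
    have "?E = (\<lambda>z. (snd (fst z []) = None \<and> t < fst (fst z [])) \<or>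
        (\<exists>k. snd (fst z []) = Some k \<and> (\<forall>i\<in>{..<k}. safe (t - fst (fst z [])) (\<lambda>u. snd z (i # u)))))"
      by (auto simp: fun_eq_iff split: option.split)
    also have "Measurable.pred (?S0 \<Otimes>\<^sub>M ?S1) \<dots>" by measurable
    finally show ?thesis .
  qed
  have Emark: "?E (Y0 \<omega>, Y1 \<omega>') \<longleftrightarrow> (case N [] \<omega> of None \<Rightarrow> t < L [] \<omega>
      | Some k \<Rightarrow> \<forall>i<k. safe (t - L [] \<omega>) (\<lambda>u. mark (i # u) \<omega>'))" for \<omega> \<omega>'
    by (auto simp: Y0_def Y1_def B_def mark_def split: option.split)
  have "ennreal (non_absorption t) = (\<integral>\<^sup>+\<omega>. indicator {z \<in> space (?S0 \<Otimes>\<^sub>M ?S1). ?E z} (Y0 \<omega>, Y1 \<omega>) \<partial>M)"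
  proof -
    have eqset: "{\<omega> \<in> space M. safe t (\<lambda>u. mark u \<omega>)} = {\<omega> \<in> space M. ?E (Y0 \<omega>, Y1 \<omega>)}"
    proof -
      have "fst (mark [] \<omega>) = L [] \<omega>" "snd (mark [] \<omega>) = N [] \<omega>" for \<omega> by (simp_all add: mark_def)
      then show ?thesis unfolding Emark safe_rec[of t "\<lambda>u. mark u _"] by (simp only:)
    qed
    have "ennreal (non_absorption t) = emeasure M {\<omega> \<in> space M. safe t (\<lambda>u. mark u \<omega>)}"
      by (simp add: non_absorption_def emeasure_eq_measure)
    also have "\<dots> = (\<integral>\<^sup>+\<omega>. indicator {\<omega> \<in> space M. safe t (\<lambda>u. mark u \<omega>)} \<omega> \<partial>M)"
      using safe_events[of t "\<lambda>u. u"] by (intro nn_integral_indicator[symmetric])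
    also have "\<dots> = (\<integral>\<^sup>+\<omega>. indicator {z \<in> space (?S0 \<Otimes>\<^sub>M ?S1). ?E z} (Y0 \<omega>, Y1 \<omega>) \<partial>M)"
      using measurable_space[OF Y0] measurable_space[OF Y1] unfolding eqset
      by (intro nn_integral_cong) (auto simp: indicator_def space_pair_measure)
    finally show ?thesis .
  qed
  also have "\<dots> = (\<integral>\<^sup>+\<omega>. (\<integral>\<^sup>+\<omega>'. indicator {z \<in> space (?S0 \<Otimes>\<^sub>M ?S1). ?E z} (Y0 \<omega>, Y1 \<omega>') \<partial>M) \<partial>M)"
    by (rule nn_integral_indep_pair[OF Y0 Y1 d]) measurable
  also have "\<dots> = (\<integral>\<^sup>+\<omega>. (\<integral>\<^sup>+\<omega>'. indicator {\<omega>' \<in> space M. ?E (Y0 \<omega>, Y1 \<omega>')} \<omega>' \<partial>M) \<partial>M)"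
    using measurable_space[OF Y0] measurable_space[OF Y1]
    by (intro nn_integral_cong) (auto simp: indicator_def space_pair_measure)
  also have "\<dots> = (\<integral>\<^sup>+\<omega>. emeasure M {\<omega>' \<in> space M. ?E (Y0 \<omega>, Y1 \<omega>')} \<partial>M)"
  proof (intro nn_integral_cong nn_integral_indicator)
    fix \<omega> assume "\<omega> \<in> space M"
    then have "(\<lambda>\<omega>'. (Y0 \<omega>, Y1 \<omega>')) \<in> measurable M (?S0 \<Otimes>\<^sub>M ?S1)"
      using measurable_space[OF Y0] by (intro measurable_Pair) auto
    from measurable_compose[OF this E] show "{\<omega>' \<in> space M. ?E (Y0 \<omega>, Y1 \<omega>')} \<in> sets M"
      by simp
  qed
  finally show ?thesis unfolding Emark emeasure_safe_given_root .
qed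

lemma gen_fun_non_absorption_summable: "summable (\<lambda>k. p k * non_absorption s ^ k)"
  by (rule gen_fun_summable_le[of p 1])
     (use offspring_nonneg offspring_summable non_absorption_bounds[of s] in simp_all)

lemma gen_fun_non_absorption_measurable: "(\<lambda>s. gen_fun p (non_absorption s)) \<in> borel_measurable borel"
proof -
  have "mono (\<lambda>s. - gen_fun p (non_absorption s))"
    by (intro monoI le_imp_neg_le gen_fun_mono offspring_nonneg gen_fun_non_absorption_summable
        non_absorption_bounds non_absorption_mono)
  then have "(\<lambda>s. - (- gen_fun p (non_absorption s))) \<in> borel_measurable borel"
    by (intro borel_measurable_uminus borel_measurable_mono)
  then show ?thesis by simp
qed

text \<open>The offspring number is averaged with the life length frozen: \<open>None\<close> counts
  only if the root outlives \<open>t\<close>, and the powers add up to the generating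
  function.\<close>

lemma non_absorption_renewal:
  "ennreal (non_absorption t) = (\<integral>\<^sup>+l. ennreal (exponential_density 1 l) *
     ennreal ((1 - suminf p) * indicator {t<..} l + gen_fun p (non_absorption (t - l))) \<partial>lborel)"
proof -
  let ?K = "\<lambda>(l, k). case k of None \<Rightarrow> indicator {t<..} l | Some k \<Rightarrow> ennreal (non_absorption (t - l) ^ k)"
  have K [measurable]: "?K \<in> borel_measurable mark_space"
  proof -
    have "(\<lambda>z. case k of None \<Rightarrow> indicator {t<..} (fst z) | Some k \<Rightarrow> ennreal (non_absorption (t - fst z) ^ k))
      \<in> borel_measurable mark_space" for k
      by (cases k) (auto intro!: measurable_compose[OF _ borel_measurable_indicator])
    then have "(\<lambda>z. (\<lambda>k z. case k of None \<Rightarrow> indicator {t<..} (fst z) | Some k \<Rightarrow> ennreal (non_absorption (t - fst z) ^ k))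
        (snd z) z) \<in> borel_measurable mark_space"
      by (rule measurable_compose_countable[OF _ measurable_snd])
    then show ?thesis by (simp add: case_prod_beta')
  qed
  have p: "(\<Sum>k. ennreal (p k) * ennreal (non_absorption s ^ k)) = ennreal (gen_fun p (non_absorption s))" for s
  proof -
    have "(\<Sum>k. ennreal (p k * non_absorption s ^ k)) = ennreal (gen_fun p (non_absorption s))"
      unfolding gen_fun_def by (rule suminf_ennreal2[OF _ gen_fun_non_absorption_summable]) (simp add: offspring_nonneg non_absorption_bounds)
    then show ?thesis by (simp add: ennreal_mult offspring_nonneg non_absorption_bounds)
  qed
  have g: "0 \<le> gen_fun p (non_absorption s)" for s
    by (rule gen_fun_nonneg[OF offspring_nonneg gen_fun_non_absorption_summable non_absorption_bounds(1)])
  note [measurable] = gen_fun_non_absorption_measurable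
  have meas: "(\<lambda>l. ennreal ((1 - suminf p) * indicator {t<..} l + gen_fun p (non_absorption (t - l)))) \<in> borel_measurable borel"
    by measurable
  have "ennreal (non_absorption t) = (\<integral>\<^sup>+\<omega>. ?K (L [] \<omega>, N [] \<omega>) \<partial>M)"
    unfolding non_absorption_root by simp
  also have "\<dots> = (\<integral>\<^sup>+\<omega>. (\<integral>\<^sup>+\<omega>'. ?K (L [] \<omega>, N [] \<omega>') \<partial>M) \<partial>M)"
    by (rule nn_integral_indep_pair[OF L_measurable N_measurable distr_L_N[unfolded mark_def[abs_def]] K])
  also have "\<dots> = (\<integral>\<^sup>+\<omega>. ennreal ((1 - suminf p) * indicator {t<..} (L [] \<omega>) + gen_fun p (non_absorption (t - L [] \<omega>))) \<partial>M)"
  proof (rule nn_integral_cong)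
    fix \<omega>
    show "(\<integral>\<^sup>+\<omega>'. ?K (L [] \<omega>, N [] \<omega>') \<partial>M)
        = ennreal ((1 - suminf p) * indicator {t<..} (L [] \<omega>) + gen_fun p (non_absorption (t - L [] \<omega>)))"
      using nn_integral_N[of "\<lambda>k. ?K (L [] \<omega>, k)" "[]"] offspring_le_1 g[of "t - L [] \<omega>"]
      by (simp add: p split: split_indicator)
  qed
  also have "\<dots> = (\<integral>\<^sup>+l. ennreal (exponential_density 1 l) *
     ennreal ((1 - suminf p) * indicator {t<..} l + gen_fun p (non_absorption (t - l))) \<partial>lborel)"
    by (rule distributed_nn_integral[OF life_exponential, symmetric]) (use meas in simp)
  finally show ?thesis .
qed

text \<open>A root that outlives \<open>t\<close> contributes the full mass
  \<open>exp (- t)\<close>, as \<open>1 - suminf p\<close> and \<open>gen_fun p 1\<close> add up to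
  \<open>1\<close>. Reversing time by \<open>s = t - l\<close> and multiplying by
  \<open>exp t\<close> makes the integrand independent of \<open>t\<close>.\<close>

lemma non_absorption_integral:
  assumes "0 \<le> t"
  shows "((\<lambda>s. exp s * gen_fun p (non_absorption s)) has_integral (exp t * non_absorption t - 1)) {0..t}"
proof -
  let ?G = "\<lambda>s. exp s * gen_fun p (non_absorption s)"
  have g: "0 \<le> gen_fun p (non_absorption s)" for s
    by (rule gen_fun_nonneg[OF offspring_nonneg gen_fun_non_absorption_summable non_absorption_bounds(1)])
  note [measurable] = gen_fun_non_absorption_measurable
  have "ennreal (non_absorption t) = (\<integral>\<^sup>+l. ennreal (exponential_density 1 l) * indicator {t<..} l
      + ennreal (exp (- l) * gen_fun p (non_absorption (t - l)) * indicator {0..t} l) \<partial>lborel)"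
    unfolding non_absorption_renewal
  proof (intro nn_integral_cong)
    fix l :: real
    have "gen_fun p (non_absorption (t - l)) = suminf p" if "t < l"
      using non_absorption_neg[of "t - l"] that by (simp add: gen_fun_def)
    then show "ennreal (exponential_density 1 l) *
          ennreal ((1 - suminf p) * indicator {t<..} l + gen_fun p (non_absorption (t - l)))
        = ennreal (exponential_density 1 l) * indicator {t<..} l
      + ennreal (exp (- l) * gen_fun p (non_absorption (t - l)) * indicator {0..t} l)"
      using assms g[of "t - l"] by (auto simp: indicator_def exponential_density_def ennreal_mult)
  qed
  also have "\<dots> = (\<integral>\<^sup>+l. ennreal (exponential_density 1 l) * indicator {t<..} l \<partial>lborel)
      + (\<integral>\<^sup>+l. ennreal (exp (- l) * gen_fun p (non_absorption (t - l)) * indicator {0..t} l) \<partial>lborel)"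
    by (rule nn_integral_add) measurable
  also have "(\<integral>\<^sup>+l. ennreal (exponential_density 1 l) * indicator {t<..} l \<partial>lborel) = ennreal (exp (- t))"
  proof -
    have "(\<integral>\<^sup>+l. ennreal (exponential_density 1 l) * indicator {t<..} l \<partial>lborel) = (\<integral>\<^sup>+\<omega>. indicator {t<..} (L [] \<omega>) \<partial>M)"
      by (rule distributed_nn_integral[OF life_exponential]) simp
    also have "\<dots> = (\<integral>\<^sup>+\<omega>. indicator {\<omega> \<in> space M. t < L [] \<omega>} \<omega> \<partial>M)"
      by (intro nn_integral_cong) (simp add: indicator_def)
    also have "\<dots> = ennreal (exp (- t))"
      using exponential_distributedD_gt[OF life_exponential assms, of "[]"] by (simp add: emeasure_eq_measure)
    finally show ?thesis .
  qed
  also have "(\<integral>\<^sup>+l. ennreal (exp (- l) * gen_fun p (non_absorption (t - l)) * indicator {0..t} l) \<partial>lborel)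
      = ennreal (exp (- t)) * (\<integral>\<^sup>+s. ennreal (?G s * indicator {0..t} s) \<partial>lborel)"
  proof -
    have "(\<integral>\<^sup>+l. ennreal (exp (- l) * gen_fun p (non_absorption (t - l)) * indicator {0..t} l) \<partial>lborel)
      = ennreal \<bar>-1\<bar> * (\<integral>\<^sup>+s. ennreal (exp (- (t + -1 * s)) * gen_fun p (non_absorption (t - (t + -1 * s)))
           * indicator {0..t} (t + -1 * s)) \<partial>lborel)"
    proof (rule nn_integral_real_affine)
      show "(\<lambda>l. ennreal (exp (- l) * gen_fun p (non_absorption (t - l)) * indicator {0..t} l)) \<in> borel_measurable borel"
        by measurable
    qed simp
    also have "\<dots> = (\<integral>\<^sup>+s. ennreal (exp (- t)) * ennreal (?G s * indicator {0..t} s) \<partial>lborel)"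
      using g by (auto intro!: nn_integral_cong simp: indicator_def exp_diff exp_minus field_simps simp flip: ennreal_mult)
    also have "\<dots> = ennreal (exp (- t)) * (\<integral>\<^sup>+s. ennreal (?G s * indicator {0..t} s) \<partial>lborel)"
      by (rule nn_integral_cmult) measurable
    finally show ?thesis .
  qed
  finally have eq: "ennreal (non_absorption t)
      = ennreal (exp (- t)) + ennreal (exp (- t)) * (\<integral>\<^sup>+s. ennreal (?G s * indicator {0..t} s) \<partial>lborel)" .
  \<comment> \<open>The left-hand side of \<open>eq\<close> is finite and the factor
    \<open>exp (- t)\<close> is not zero.\<close>
  then have "(\<integral>\<^sup>+s. ennreal (?G s * indicator {0..t} s) \<partial>lborel) \<noteq> \<top>"
    by (auto simp: ennreal_mult_top)
  then obtain r where r: "0 \<le> r" "(\<integral>\<^sup>+s. ennreal (?G s * indicator {0..t} s) \<partial>lborel) = ennreal r"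
    by (cases "\<integral>\<^sup>+s. ennreal (?G s * indicator {0..t} s) \<partial>lborel") auto
  have "ennreal (non_absorption t) = ennreal (exp (- t) + exp (- t) * r)"
    using eq r by (simp add: ennreal_mult)
  then have "non_absorption t = exp (- t) + exp (- t) * r"
    by (rule ennreal_inj[THEN iffD1, rotated 2]) (use r non_absorption_bounds(1) in auto)
  then have "r = exp t * non_absorption t - 1"
    by (simp add: exp_minus field_simps)
  moreover have "((\<lambda>s. ?G s * indicator {0..t} s) has_integral r) UNIV"
    by (rule nn_integral_has_integral) (use r g in \<open>auto\<close>)
  then have "(?G has_integral r) {0..t}"
  proof -
    assume "((\<lambda>s. ?G s * indicator {0..t} s) has_integral r) UNIV"
    moreover have "(\<lambda>s. ?G s * indicator {0..t} s) = (\<lambda>s. if s \<in> {0..t} then ?G s else 0)"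
      by (auto simp: indicator_def)
    ultimately show ?thesis by (simp only: has_integral_restrict_UNIV)
  qed
  ultimately show ?thesis by simp
qed

lemma non_absorption_0: "non_absorption 0 = 1"
  using integral_unique[OF non_absorption_integral[of 0]] by simp

section \<open>The termination time as an infimum\<close>

lemma population_None_iff: "population L N t \<omega> = None \<longleftrightarrow> \<not> safe t (\<lambda>u. mark u \<omega>)"
  unfolding mark_def safe_field by (simp add: population_def Let_def)

lemma prob_not_safe: "prob {\<omega> \<in> space M. \<not> safe t (\<lambda>u. mark u \<omega>)} = 1 - non_absorption t"
  unfolding non_absorption_def using safe_events[of t "\<lambda>u. u"] by (simp add: prob_neg)

text \<open>Among infinitely many particles graveyard jumps may accumulate, so the infimum need not
  be attained and \<open>t\<close> is approached from the right.\<close>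

lemma termination_time_le_iff:
  assumes "0 \<le> t"
  shows "termination_time L N \<omega> \<le> ereal t \<longleftrightarrow> (\<forall>m :: nat. \<not> safe (t + inverse (real (Suc m))) (\<lambda>u. mark u \<omega>))"
proof
  assume le: "termination_time L N \<omega> \<le> ereal t"
  show "\<forall>m :: nat. \<not> safe (t + inverse (real (Suc m))) (\<lambda>u. mark u \<omega>)"
  proof
    fix m :: nat
    have "ereal t < ereal (t + inverse (real (Suc m)))" by simp
    with le have "termination_time L N \<omega> < ereal (t + inverse (real (Suc m)))" by (rule le_less_trans)
    then obtain s where s: "s < t + inverse (real (Suc m))" "\<not> safe s (\<lambda>u. mark u \<omega>)"
      unfolding termination_time_def INF_less_iff population_None_iff by auto
    then show "\<not> safe (t + inverse (real (Suc m))) (\<lambda>u. mark u \<omega>)" using safe_antimono[OF less_imp_le[OF s(1)]] s(2) by auto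
  qed
next
  assume *: "\<forall>m :: nat. \<not> safe (t + inverse (real (Suc m))) (\<lambda>u. mark u \<omega>)"
  have "termination_time L N \<omega> \<le> ereal (t + inverse (real (Suc m)))" for m
    unfolding termination_time_def population_None_iff using * assms by (intro INF_lower) auto
  then have le: "\<exists>k. \<forall>m\<ge>k. termination_time L N \<omega> \<le> ereal (t + inverse (real (Suc m)))" by blast
  have "(\<lambda>m. ereal (t + inverse (real (Suc m)))) \<longlonglongrightarrow> ereal (t + 0)"
    by (intro tendsto_ereal tendsto_intros LIMSEQ_inverse_real_of_nat)
  then show "termination_time L N \<omega> \<le> ereal t"
    using le by (intro LIMSEQ_le_const[of _ "ereal t"]) simp_all
qed

lemma termination_time_less_infinity_iff:
  "termination_time L N \<omega> < \<infinity> \<longleftrightarrow> (\<exists>m :: nat. \<not> safe (real m) (\<lambda>u. mark u \<omega>))"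
proof -
  have "termination_time L N \<omega> < \<infinity> \<longleftrightarrow> (\<exists>t\<ge>0. \<not> safe t (\<lambda>u. mark u \<omega>))"
    unfolding termination_time_def INF_less_iff population_None_iff by auto
  also have "\<dots> \<longleftrightarrow> (\<exists>m :: nat. \<not> safe (real m) (\<lambda>u. mark u \<omega>))"
  proof
    assume "\<exists>t\<ge>0. \<not> safe t (\<lambda>u. mark u \<omega>)"
    then obtain t where t: "\<not> safe t (\<lambda>u. mark u \<omega>)" by auto
    moreover obtain m :: nat where "t \<le> real m" using real_arch_simple by blast
    ultimately show "\<exists>m :: nat. \<not> safe (real m) (\<lambda>u. mark u \<omega>)" using safe_antimono by (intro exI[of _ m]) auto
  qed (auto intro: of_nat_0_le_iff)
  finally show ?thesis .
qed

section \<open>The differential equation for \<open>h\<close> and its limit at infinity\<close>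

context
  fixes R :: real
  assumes R: "1 < R" "summable (\<lambda>k. p k * R ^ k)"
begin

text \<open>Integrability alone makes the right-hand side of the integral equation continuous; fed
  back into the integrand, this yields differentiability in
  \<open>non_absorption_ODE\<close>.\<close>

lemma non_absorption_continuous_on: "continuous_on {0..b} non_absorption"
proof -
  let ?G = "\<lambda>s. exp s * gen_fun p (non_absorption s)"
  have eq: "non_absorption t = exp (- t) * (1 + integral {0..t} ?G)" if "t \<in> {0..b}" for t
    using integral_unique[OF non_absorption_integral[of t]] that by (simp add: exp_minus field_simps)
  show ?thesis
  proof (cases "0 \<le> b")
    case True
    have "continuous_on {0..b} (\<lambda>t. exp (- t) * (1 + integral {0..t} ?G))"
      by (intro continuous_intros indefinite_integral_continuous_1 has_integral_integrable[OF non_absorption_integral] True)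
    then show ?thesis by (rule continuous_on_eq) (simp add: eq)
  qed simp
qed

lemma non_absorption_ODE:
  assumes "t \<in> {0..b}"
  shows "(non_absorption has_real_derivative gen_fun p (non_absorption t) - non_absorption t) (at t within {0..b})"
proof -
  let ?G = "\<lambda>s. exp s * gen_fun p (non_absorption s)"
  have eq: "non_absorption t = exp (- t) * (1 + integral {0..t} ?G)" if "t \<in> {0..b}" for t
    using integral_unique[OF non_absorption_integral[of t]] that by (simp add: exp_minus field_simps)
  have "continuous_on {0..b} (\<lambda>s. gen_fun p (non_absorption s))"
    by (rule continuous_on_compose2[OF gen_fun_continuous_on[OF R(2), of "{0..1}"] non_absorption_continuous_on])
       (use R non_absorption_bounds in auto)
  then have "continuous_on {0..b} ?G" by (intro continuous_intros)
  from integral_has_real_derivative[OF this assms]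
  have "((\<lambda>t. exp (- t) * (1 + integral {0..t} ?G)) has_real_derivative
      exp (- t) * ?G t - exp (- t) * (1 + integral {0..t} ?G)) (at t within {0..b})"
    by (auto intro!: derivative_eq_intros)
  moreover have "exp (- t) * ?G t - exp (- t) * (1 + integral {0..t} ?G) = gen_fun p (non_absorption t) - non_absorption t"
    using eq[OF assms] by (simp add: exp_minus)
  ultimately have "((\<lambda>t. exp (- t) * (1 + integral {0..t} ?G)) has_real_derivative
      gen_fun p (non_absorption t) - non_absorption t) (at t within {0..b})" by (simp only:)
  then show ?thesis
    by (rule has_field_derivative_transform_within[where d = 1]) (use assms eq in auto)
qed

text \<open>The events at times \<open>t + 1 / (m + 1)\<close> decrease to the event in question,
  and continuity of \<open>h\<close> identifies the limit.\<close>

lemma prob_termination_time_le: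
  assumes "0 \<le> t"
  shows "prob {\<omega> \<in> space M. termination_time L N \<omega> \<le> ereal t} = 1 - non_absorption t"
proof (rule LIMSEQ_unique)
  let ?A = "\<lambda>m. {\<omega> \<in> space M. \<not> safe (t + inverse (real (Suc m))) (\<lambda>u. mark u \<omega>)}"
  have "(\<lambda>m. prob (?A m)) \<longlonglongrightarrow> prob (\<Inter>m. ?A m)"
  proof (rule finite_Lim_measure_decseq)
    show "decseq ?A"
      by (intro decseq_SucI) (auto elim!: contrapos_nn intro: safe_antimono[rotated] simp: field_simps)
  qed (auto intro!: sets.sets_Collect_neg safe_events)
  moreover have "(\<Inter>m. ?A m) = {\<omega> \<in> space M. termination_time L N \<omega> \<le> ereal t}"
    using termination_time_le_iff[OF assms] by auto
  ultimately show "(\<lambda>m. prob (?A m)) \<longlonglongrightarrow> prob {\<omega> \<in> space M. termination_time L N \<omega> \<le> ereal t}" by simp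
  have "(\<lambda>m. t + inverse (real (Suc m))) \<longlonglongrightarrow> t + 0"
    by (intro tendsto_intros LIMSEQ_inverse_real_of_nat)
  then have "(\<lambda>m. non_absorption (t + inverse (real (Suc m)))) \<longlonglongrightarrow> non_absorption t"
    using continuous_on_tendsto_compose[OF non_absorption_continuous_on[of "t + 1"], of "\<lambda>m. t + inverse (real (Suc m))" t sequentially] assms
    by (auto intro!: always_eventually simp: inverse_le_1_iff)
  then show "(\<lambda>m. prob (?A m)) \<longlonglongrightarrow> 1 - non_absorption t"
    unfolding prob_not_safe by (intro tendsto_intros)
qed

context
  fixes q :: real
  assumes defective: "suminf p < 1" and q: "0 \<le> q" "q < 1" "gen_fun p q = q"
begin

text \<open>As \<open>non_absorption\<close> is non-increasing, before the first passage of the level \<open>q\<close> it stays above \<open>q\<close>,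
  and there \<open>e\<^sup>t (h(t) - q)\<close> is non-decreasing.\<close>

lemma non_absorption_gt:
  assumes "0 \<le> t"
  shows "q < non_absorption t"
proof (rule ccontr)
  assume "\<not> ?thesis"
  then obtain b where b: "0 \<le> b" "non_absorption b = q"
    using IVT2'[of non_absorption t q 0] assms non_absorption_continuous_on[of t] q non_absorption_0 by auto
  let ?F = "\<lambda>t. exp t * (non_absorption t - q)"
  have "?F 0 \<le> ?F b"
  proof (rule DERIV_nonneg_imp_increasing_open[OF b(1)])
    have "continuous_on {0..b} ?F" by (intro continuous_intros non_absorption_continuous_on)
    then show "continuous_on {0..b} ?F" .
    fix s assume s: "0 < s" "s < b"
    have "(non_absorption has_real_derivative gen_fun p (non_absorption s) - non_absorption s) (at s)"
      using non_absorption_ODE[of s b] s by (simp add: at_within_Icc_at)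
    then have "(?F has_real_derivative exp s * (gen_fun p (non_absorption s) - q)) (at s)"
      by (auto intro!: derivative_eq_intros simp: algebra_simps)
    moreover have "q \<le> non_absorption s" using non_absorption_mono[of s b] s b by simp
    then have "q \<le> gen_fun p (non_absorption s)"
      using gen_fun_mono[OF offspring_nonneg gen_fun_non_absorption_summable q(1)] q(3) by metis
    ultimately show "\<exists>y. (?F has_real_derivative y) (at s) \<and> 0 \<le> y" by auto
  qed
  then show False using b q non_absorption_0 by simp
qed

text \<open>A limit \<open>l > q\<close> would keep \<open>h\<close> in \<open>[l, 1]\<close>, where
  \<open>f(x) - x\<close> has a negative maximum; \<open>h\<close> would fall at least linearly and
  become negative.\<close>

lemma non_absorption_tendsto: "(\<lambda>n :: nat. non_absorption (real n)) \<longlonglongrightarrow> q"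
proof -
  have dec: "decseq (\<lambda>n :: nat. non_absorption (real n))"
    by (intro decseq_SucI non_absorption_mono) simp
  obtain l where l: "(\<lambda>n :: nat. non_absorption (real n)) \<longlonglongrightarrow> l" "\<And>n. l \<le> non_absorption (real n)"
    using decseq_convergent[OF dec, of 0] non_absorption_bounds by auto
  have ql: "q \<le> l" by (rule LIMSEQ_le_const[OF l(1)]) (use non_absorption_gt in \<open>force intro: less_imp_le\<close>)
  have l_le: "l \<le> non_absorption t" for t
    using l(2)[of "nat \<lceil>t\<rceil>"] non_absorption_mono[of t "real (nat \<lceil>t\<rceil>)"] by linarith
  have "l = q"
  proof (rule ccontr)
    assume "l \<noteq> q"
    then have l1: "q < l" "l \<le> 1" using ql l_le[of 0] non_absorption_0 by auto
    let ?D = "\<lambda>x. gen_fun p x - x"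
    have "continuous_on {l..1} ?D"
      using R l1 q by (intro continuous_intros gen_fun_continuous_on[OF R(2)]) auto
    then obtain m where m: "m \<in> {l..1}" "\<And>x. x \<in> {l..1} \<Longrightarrow> ?D x \<le> ?D m"
      using continuous_attains_sup[of "{l..1}" ?D] l1 by auto
    have neg: "?D m < 0"
      using gen_fun_less_id_left[OF offspring_nonneg R(2,1), of q m] m l1 q defective
      by (simp add: gen_fun_def)
    have "non_absorption t \<le> 1 + t * ?D m" if t: "0 < t" for t
    proof -
      obtain z where z: "0 < z" "z < t" "non_absorption t - non_absorption 0 = (t - 0) * ?D (non_absorption z)"
      proof -
        have "\<exists>z\<in>{0<..<t}. non_absorption t - non_absorption 0 = ?D (non_absorption z) * (t - 0)"
          by (rule mvt_simple) (use t non_absorption_ODE in \<open>auto simp: has_field_derivative_def\<close>)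
        then show ?thesis using that by (auto simp: mult.commute)
      qed
      have "t * ?D (non_absorption z) \<le> t * ?D m"
        using m(2)[of "non_absorption z"] l_le[of z] non_absorption_bounds[of z] t by (intro mult_left_mono) auto
      then show ?thesis using z(3) unfolding non_absorption_0 diff_zero by linarith
    qed
    \<comment> \<open>At this time the linear bound equals \<open>-1\<close>.\<close>
    from this[of "2 / - ?D m"] have "non_absorption (2 / - ?D m) \<le> 1 + 2 / - ?D m * ?D m"
      using neg by (simp add: divide_pos_neg zero_less_divide_iff)
    also have "2 / - ?D m * ?D m = - 2" using neg by (simp add: field_simps)
    finally show False using non_absorption_bounds(1)[of "2 / - ?D m"] by linarith
  qed
  with l(1) show ?thesis by simp
qed

lemma prob_termination_time_finite:
  "prob {\<omega> \<in> space M. termination_time L N \<omega> < \<infinity>} = 1 - q"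
proof (rule LIMSEQ_unique)
  let ?A = "\<lambda>m :: nat. {\<omega> \<in> space M. \<not> safe (real m) (\<lambda>u. mark u \<omega>)}"
  have "(\<lambda>m. prob (?A m)) \<longlonglongrightarrow> prob (\<Union>m. ?A m)"
  proof (rule finite_Lim_measure_incseq)
    show "incseq ?A"
      by (intro incseq_SucI) (auto elim!: contrapos_nn intro: safe_antimono[rotated])
  qed (auto intro!: sets.sets_Collect_neg safe_events)
  moreover have "(\<Union>m. ?A m) = {\<omega> \<in> space M. termination_time L N \<omega> < \<infinity>}"
    using termination_time_less_infinity_iff by auto
  ultimately show "(\<lambda>m. prob (?A m)) \<longlonglongrightarrow> prob {\<omega> \<in> space M. termination_time L N \<omega> < \<infinity>}" by simp
  show "(\<lambda>m. prob (?A m)) \<longlonglongrightarrow> 1 - q"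
    unfolding prob_not_safe by (intro tendsto_intros non_absorption_tendsto)
qed

lemma cond_prob_termination_time:
  assumes "0 \<le> t"
  shows "cond_prob M (\<lambda>\<omega>. termination_time L N \<omega> \<le> ereal t) (\<lambda>\<omega>. termination_time L N \<omega> < \<infinity>)
    = (1 - non_absorption t) / (1 - q)"
proof -
  have "{\<omega> \<in> space M. termination_time L N \<omega> \<le> ereal t \<and> termination_time L N \<omega> < \<infinity>}
      = {\<omega> \<in> space M. termination_time L N \<omega> \<le> ereal t}"
    by (auto intro: le_less_trans)
  then show ?thesis
    using prob_termination_time_le[OF assms] prob_termination_time_finite by (simp add: cond_prob_def)
qed

end

end

end

section \<open>Convergent offspring laws\<close>

text \<open>The processes along a sequence of parameters, reduced to the analytic properties of
  \<open>h\<close>, so that the limits are pure analysis; sequences also give access to dominated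
  convergence.\<close>

locale offspring_sequence =
  fixes P :: "nat \<Rightarrow> nat \<Rightarrow> real" and f :: "nat \<Rightarrow> real" and s0 :: real and q r :: "nat \<Rightarrow> real"
    and h :: "nat \<Rightarrow> real \<Rightarrow> real"
  assumes s0: "1 < s0"
    and f_nonneg: "\<And>k. 0 \<le> f k" and f_summable: "summable (\<lambda>k. f k * s0 ^ k)" and f_1: "gen_fun f 1 = 1"
    and P_nonneg: "\<And>n k. 0 \<le> P n k" and P_summable: "\<And>n. summable (\<lambda>k. P n k * s0 ^ k)"
    and P_1: "\<And>n. gen_fun (P n) 1 < 1"
    and P_tendsto: "\<And>s. 0 \<le> s \<Longrightarrow> s \<le> s0 \<Longrightarrow> (\<lambda>n. gen_fun (P n) s) \<longlonglongrightarrow> gen_fun f s"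
    and q: "\<And>n. 0 \<le> q n" "\<And>n. q n < 1" "\<And>n. gen_fun (P n) (q n) = q n"
    and r: "\<And>n. 1 < r n" "\<And>n. summable (\<lambda>k. P n k * r n ^ k)" "\<And>n. gen_fun (P n) (r n) = r n"
    and h_0: "\<And>n. h n 0 = 1" and h_gt: "\<And>n t. 0 \<le> t \<Longrightarrow> q n < h n t" and h_le: "\<And>n t. h n t \<le> 1"
    and h_mono: "\<And>n s t. s \<le> t \<Longrightarrow> h n t \<le> h n s"
    and h_ODE: "\<And>n b t. t \<in> {0..b} \<Longrightarrow>
      (h n has_real_derivative gen_fun (P n) (h n t) - h n t) (at t within {0..b})"
begin

abbreviation m1 :: real where "m1 \<equiv> gen_fun (diffs f) 1"

text \<open>A point strictly inside \<open>(1, s0)\<close>: values are controlled up to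
  \<open>s0\<close>, derivatives only up to a smaller point.\<close>

definition s1 :: real where "s1 = (1 + s0) / 2"

lemma s1: "1 < s1" "s1 < s0" using s0 by (auto simp: s1_def field_simps)

text \<open>\<open>gen_fun_diffs_le\<close> is applied twice, each time giving up part of the gap
  between \<open>s0\<close> and \<open>s1\<close>. The values at \<open>s0\<close> are bounded
  because they converge.\<close>

lemma bounded_second_derivatives:
  obtains B where "0 \<le> B" "\<And>n x. 0 \<le> x \<Longrightarrow> x \<le> s1 \<Longrightarrow> gen_fun (diffs (diffs (P n))) x \<le> B"
    "\<And>x. 0 \<le> x \<Longrightarrow> x \<le> s1 \<Longrightarrow> gen_fun (diffs (diffs f)) x \<le> B"
proof -
  obtain c where "s1 < c" "c < s0" using dense[OF s1(2)] by auto
  moreover from this obtain b where "s1 < b" "b < c" using dense[of s1 c] by auto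
  moreover from this obtain a where "s1 < a" "a < b" using dense[of s1 b] by auto
  ultimately have abc: "1 < s1" "s1 < a" "a < b" "b < c" "c < s0" using s1 by auto
  have "Bseq (\<lambda>n. gen_fun (P n) s0)"
    using P_tendsto[of s0] s0 by (intro convergent_imp_Bseq convergentI) auto
  then obtain K where K: "\<And>n. gen_fun (P n) s0 \<le> K"
    unfolding Bseq_def by (metis abs_le_D1 real_norm_def)
  define B where "B = max K (gen_fun f s0) / (c - b) / (a - s1)"
  have bound: "gen_fun (diffs (diffs v)) x \<le> B"
    if v: "\<And>k. 0 \<le> v k" "summable (\<lambda>k. v k * s0 ^ k)" "gen_fun v s0 \<le> max K (gen_fun f s0)"
      and x: "0 \<le> x" "x \<le> s1" for v x
  proof -
    have d: "summable (\<lambda>k. diffs v k * b ^ k)" using v abc by (intro diffs_summable[OF v(2)]) auto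
    have "gen_fun (diffs v) b \<le> gen_fun v s0 / (c - b)"
      by (rule gen_fun_diffs_le[OF v(1,2)]) (use abc in auto)
    also have "\<dots> \<le> max K (gen_fun f s0) / (c - b)" using v(3) abc by (intro divide_right_mono) auto
    finally have 1: "gen_fun (diffs v) b \<le> max K (gen_fun f s0) / (c - b)" .
    have "gen_fun (diffs (diffs v)) x \<le> gen_fun (diffs (diffs v)) s1"
      by (rule gen_fun_mono) (use x abc v(1) in \<open>auto intro!: diffs_nonneg diffs_summable[OF d]\<close>)
    also have "\<dots> \<le> gen_fun (diffs v) b / (a - s1)"
      by (rule gen_fun_diffs_le[OF diffs_nonneg[OF v(1)] d]) (use abc in auto)
    also have "\<dots> \<le> B" unfolding B_def using 1 abc by (intro divide_right_mono) auto
    finally show ?thesis .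
  qed
  show ?thesis
  proof (rule that)
    show "0 \<le> B"
      unfolding B_def using abc gen_fun_nonneg[OF f_nonneg f_summable] s0
      by (intro divide_nonneg_nonneg) (auto simp: le_max_iff_disj)
    show "gen_fun (diffs (diffs (P n))) x \<le> B" if "0 \<le> x" "x \<le> s1" for n x
      using that K by (intro bound[OF P_nonneg P_summable]) (auto simp: le_max_iff_disj)
    show "gen_fun (diffs (diffs f)) x \<le> B" if "0 \<le> x" "x \<le> s1" for x
      using that by (intro bound[OF f_nonneg f_summable]) auto
  qed
qed

lemma diffs_P_summable: "summable (\<lambda>k. diffs (P n) k * s1 ^ k)"
  using diffs_summable[OF P_summable] s1 by simp

text \<open>The derivative at \<open>1\<close> lies at most \<open>B * d\<close> below the
  difference quotient over \<open>[1, 1 + d]\<close>, and these quotients converge. The uniform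
  Lipschitz constant \<open>B\<close> then carries the limit from \<open>1\<close> to
  \<open>x n\<close>.\<close>

lemma diffs_tendsto:
  assumes x: "x \<longlonglongrightarrow> 1" "\<And>n. 0 \<le> x n"
  shows "(\<lambda>n. gen_fun (diffs (P n)) (x n)) \<longlonglongrightarrow> m1"
proof -
  obtain B where B: "0 \<le> B" "\<And>n x. 0 \<le> x \<Longrightarrow> x \<le> s1 \<Longrightarrow> gen_fun (diffs (diffs (P n))) x \<le> B"
    "\<And>x. 0 \<le> x \<Longrightarrow> x \<le> s1 \<Longrightarrow> gen_fun (diffs (diffs f)) x \<le> B"
    by (rule bounded_second_derivatives) blast
  have lip: "gen_fun (diffs v) y - gen_fun (diffs v) x \<le> B * (y - x)"
    if v: "\<And>k. 0 \<le> v k" "summable (\<lambda>k. v k * s0 ^ k)" "\<And>x. 0 \<le> x \<Longrightarrow> x \<le> s1 \<Longrightarrow> gen_fun (diffs (diffs v)) x \<le> B"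
      and xy: "0 \<le> x" "x \<le> y" "y < s1" for v x y
  proof -
    have "gen_fun (diffs v) y - gen_fun (diffs v) x \<le> (y - x) * gen_fun (diffs (diffs v)) y"
      by (rule gen_fun_diff_bounds(2)[OF diffs_nonneg[OF v(1)] diffs_summable[OF v(2)] xy]) (use s1 in auto)
    also have "\<dots> \<le> (y - x) * B" using xy by (intro mult_left_mono v(3)) auto
    finally show ?thesis by (simp add: mult.commute)
  qed
  have slope: "gen_fun (diffs v) 1 \<le> (gen_fun v (1 + d) - gen_fun v 1) / d
      \<and> (gen_fun v (1 + d) - gen_fun v 1) / d - B * d \<le> gen_fun (diffs v) 1"
    if v: "\<And>k. 0 \<le> v k" "summable (\<lambda>k. v k * s0 ^ k)" "\<And>x. 0 \<le> x \<Longrightarrow> x \<le> s1 \<Longrightarrow> gen_fun (diffs (diffs v)) x \<le> B"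
      and d: "0 < d" "1 + d < s1" for v d
  proof -
    have "((1 + d) - 1) * gen_fun (diffs v) 1 \<le> gen_fun v (1 + d) - gen_fun v 1"
      by (rule gen_fun_diff_bounds(1)[OF v(1,2)]) (use d s1 in auto)
    then have "gen_fun (diffs v) 1 \<le> (gen_fun v (1 + d) - gen_fun v 1) / d"
      using d by (simp add: pos_le_divide_eq mult.commute)
    moreover have "gen_fun v (1 + d) - gen_fun v 1 \<le> ((1 + d) - 1) * gen_fun (diffs v) (1 + d)"
      by (rule gen_fun_diff_bounds(2)[OF v(1,2)]) (use d s1 in auto)
    then have "(gen_fun v (1 + d) - gen_fun v 1) / d \<le> gen_fun (diffs v) (1 + d)"
      using d by (simp add: pos_divide_le_eq mult.commute)
    moreover have "gen_fun (diffs v) (1 + d) - gen_fun (diffs v) 1 \<le> B * ((1 + d) - 1)"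
      by (rule lip[OF v]) (use d in auto)
    ultimately show ?thesis by simp
  qed
  have 1: "(\<lambda>n. gen_fun (diffs (P n)) 1) \<longlonglongrightarrow> m1"
  proof (rule LIMSEQ_I)
    fix e :: real assume e: "0 < e"
    \<comment> \<open>Keeps \<open>1 + d\<close> below \<open>s1\<close> and makes
      \<open>B * d < e / 2\<close>; the other half of \<open>e\<close> pays for the difference
      quotients.\<close>
    define d where "d = min ((s1 - 1) / 2) (e / 2 / (B + 1))"
    have d: "0 < d" "1 + d < s1" using s1 e B(1) by (auto simp: d_def min_def field_simps)
    have "d * (B + 1) \<le> e / 2 / (B + 1) * (B + 1)" using B(1) by (intro mult_right_mono) (auto simp: d_def)
    also have "\<dots> = e / 2" by (rule nonzero_eq_divide_eq[THEN iffD1, OF _ refl]) (use B(1) in simp)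
    finally have Bd: "B * d < e / 2" using d(1) by (simp add: algebra_simps)
    let ?S = "\<lambda>v. (gen_fun v (1 + d) - gen_fun v 1) / d"
    have "(\<lambda>n. ?S (P n)) \<longlonglongrightarrow> ?S f"
      by (intro tendsto_intros P_tendsto) (use d s1 in auto)
    from LIMSEQ_D[OF this, of "e / 2"] e obtain n0 where n0: "\<And>n. n \<ge> n0 \<Longrightarrow> norm (?S (P n) - ?S f) < e / 2" by auto
    have "norm (gen_fun (diffs (P n)) 1 - m1) < e" if "n \<ge> n0" for n
      using n0[OF that] slope[OF P_nonneg P_summable B(2) d, of n] slope[OF f_nonneg f_summable B(3) d] Bd
      unfolding real_norm_def by linarith
    then show "\<exists>n0. \<forall>n\<ge>n0. norm (gen_fun (diffs (P n)) 1 - m1) < e" by blast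
  qed
  have "(\<lambda>n. gen_fun (diffs (P n)) (x n) - gen_fun (diffs (P n)) 1) \<longlonglongrightarrow> 0"
  proof (rule Lim_null_comparison)
    show "(\<lambda>n. B * \<bar>x n - 1\<bar>) \<longlonglongrightarrow> 0"
      using x(1) by (intro tendsto_mult_right_zero tendsto_rabs_zero) (simp add: LIM_zero)
    show "\<forall>\<^sub>F n in sequentially. norm (gen_fun (diffs (P n)) (x n) - gen_fun (diffs (P n)) 1) \<le> B * \<bar>x n - 1\<bar>"
      using order_tendstoD(2)[OF x(1) s1(1)]
    proof eventually_elim
      case (elim n)
      have "mono_on {0..<s1} (gen_fun (diffs (P n)))"
        using s1 by (intro mono_onI gen_fun_mono diffs_nonneg P_nonneg diffs_summable[OF P_summable]) auto
      then have "x n \<le> 1 \<Longrightarrow> gen_fun (diffs (P n)) (x n) \<le> gen_fun (diffs (P n)) 1"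
         "1 \<le> x n \<Longrightarrow> gen_fun (diffs (P n)) 1 \<le> gen_fun (diffs (P n)) (x n)"
        using elim x(2)[of n] s1 by (auto elim!: mono_onD)
      then show ?case
        using lip[OF P_nonneg P_summable B(2), of "x n" 1 n] lip[OF P_nonneg P_summable B(2), of 1 "x n" n] x(2)[of n] elim s1
        by (cases "x n \<le> 1") (auto simp: abs_if)
    qed
  qed
  from tendsto_add[OF this 1] show ?thesis by simp
qed

section \<open>Localization of the fixed points \<open>q n\<close> and \<open>r n\<close>\<close>

lemma P_less_id: "q n < x \<Longrightarrow> x < r n \<Longrightarrow> gen_fun (P n) x < x"
  using gen_fun_less_id_left[OF P_nonneg P_summable s0 P_1 q(1,3), of n x]
    gen_fun_less_id_right[OF P_nonneg r(2) order_refl P_1 r(3), of x n]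
  by (cases "x \<le> 1") auto

text \<open>The strict inequality at \<open>x\<close> passes to \<open>P n\<close>, which lies below
  the diagonal on all of \<open>(q n, r n)\<close>; so \<open>x\<close> must be to the left of
  \<open>q n\<close>.\<close>

lemma q_gt_eventually:
  assumes "0 \<le> x" "x < 1" "x < gen_fun f x"
  shows "eventually (\<lambda>n. x < q n) sequentially"
  using order_tendstoD(1)[OF P_tendsto[of x] assms(3)] assms s0
proof (auto elim!: eventually_mono)
  fix n assume "x < gen_fun (P n) x"
  then show "x < q n" using P_less_id[of n x] r(1)[of n] q(3)[of n] assms by (cases "x = q n"; force)
qed

lemma q_less_eventually:
  assumes "0 \<le> x" "x < 1" "gen_fun f x < x"
  shows "eventually (\<lambda>n. q n < x) sequentially"
  using order_tendstoD(2)[OF P_tendsto[of x] assms(3)] assms s0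
proof (auto elim!: eventually_mono)
  fix n assume *: "gen_fun (P n) x < x"
  show "q n < x"
  proof (rule ccontr)
    assume "\<not> ?thesis"
    \<comment> \<open>If \<open>x \<le> q n\<close>, the chord over \<open>[x, 1]\<close> would put
      \<open>P n\<close> strictly below the diagonal at its own fixed point.\<close>
    then have "(1 - x) * (gen_fun (P n) (q n) - q n)
        \<le> (1 - q n) * (gen_fun (P n) x - x) + (q n - x) * (gen_fun (P n) 1 - 1)"
      using assms q[of n] s0 by (intro gen_fun_chord[OF P_nonneg P_summable]) auto
    also have "\<dots> < 0"
      using * q[of n] P_1[of n] \<open>\<not> q n < x\<close> by (intro add_neg_nonpos mult_pos_neg mult_nonneg_nonpos) auto
    finally show False using q[of n] by simp
  qed
qed

lemma r_less_eventually:
  assumes "1 < x" "x \<le> s0" "x < gen_fun f x"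
  shows "eventually (\<lambda>n. r n < x) sequentially"
  using order_tendstoD(1)[OF P_tendsto[of x] assms(3)] assms s0
proof (auto elim!: eventually_mono)
  fix n assume "x < gen_fun (P n) x"
  then show "r n < x" using P_less_id[of n x] q(2)[of n] r(3)[of n] assms by (cases "x = r n"; force)
qed

lemma f_tangent: "0 \<le> x \<Longrightarrow> x \<le> s0 \<Longrightarrow> 1 + (x - 1) * m1 \<le> gen_fun f x"
  using gen_fun_tangent[OF f_nonneg f_summable, of 1 x] s0 f_1 by simp

lemma q_tendsto_1:
  assumes "m1 < 1"
  shows "q \<longlonglongrightarrow> 1"
proof (rule order_tendstoI)
  fix a :: real assume "a < 1"
  define x where "x = max a 0"
  have x: "0 \<le> x" "x < 1" "a \<le> x" using \<open>a < 1\<close> by (auto simp: x_def)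
  have "(1 - x) * m1 < (1 - x) * 1" using x assms by (intro mult_strict_left_mono) auto
  then have "x < gen_fun f x" using f_tangent[of x] x s0 by (simp add: algebra_simps)
  from q_gt_eventually[OF x(1,2) this] show "eventually (\<lambda>n. a < q n) sequentially"
    by eventually_elim (use x in simp)
qed (use q(2) in \<open>auto intro!: always_eventually intro: less_trans\<close>)

text \<open>\<open>z = h - q\<close> satisfies \<open>z' = f(h) - f(q) - z\<close>, and the chord
  from \<open>q\<close> to \<open>h\<close> has slope between \<open>f'(q)\<close> and
  \<open>f'(1)\<close>. Integrating factors put \<open>z\<close> between two exponentials, whose
  rates share the limit \<open>m1 - 1\<close>.\<close>

lemma subcritical_limit:
  assumes "m1 < 1" "0 \<le> t"
  shows "(\<lambda>n. (1 - h n t) / (1 - q n)) \<longlonglongrightarrow> 1 - exp (- (1 - m1) * t)"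
proof -
  let ?a = "\<lambda>n. gen_fun (diffs (P n)) (q n) - 1" and ?b = "\<lambda>n. gen_fun (diffs (P n)) 1 - 1"
  let ?z = "\<lambda>n s. h n s - q n"
  have bounds: "(1 - q n) * exp (?a n * t) \<le> ?z n t" "?z n t \<le> (1 - q n) * exp (?b n * t)" for n
  proof -
    have cont: "continuous_on {0..t} (h n)"
      using h_ODE[of _ t n] by (rule DERIV_continuous_on)
    have D: "((\<lambda>s. exp (- c * s) * ?z n s) has_real_derivative
        exp (- c * s) * ((gen_fun (P n) (h n s) - gen_fun (P n) (q n)) - (1 + c) * ?z n s)) (at s)"
      if "0 < s" "s < t" for s c
    proof -
      have "(h n has_real_derivative gen_fun (P n) (h n s) - h n s) (at s)"
        using h_ODE[of s t n] that by (simp add: at_within_Icc_at)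
      then show ?thesis using q(3)[of n] by (auto intro!: derivative_eq_intros simp: algebra_simps)
    qed
    have hs: "0 < ?z n s" "h n s < s0" "h n s \<le> 1" if "0 < s" for s
      using h_gt[of s n] h_le[of n s] s0 that by auto
    have "exp (- ?a n * 0) * ?z n 0 \<le> exp (- ?a n * t) * ?z n t"
    proof (rule DERIV_nonneg_imp_increasing_open[OF assms(2)])
      show "continuous_on {0..t} (\<lambda>s. exp (- ?a n * s) * ?z n s)" by (intro continuous_intros cont)
      fix s assume s: "0 < s" "s < t"
      have "?z n s * gen_fun (diffs (P n)) (q n) \<le> gen_fun (P n) (h n s) - gen_fun (P n) (q n)"
        using hs[of s] s q(1)[of n] by (intro gen_fun_diff_bounds(1)[OF P_nonneg P_summable]) auto
      then show "\<exists>y. ((\<lambda>s. exp (- ?a n * s) * ?z n s) has_real_derivative y) (at s) \<and> 0 \<le> y"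
        by - (rule exI, rule conjI, rule D[OF s], simp add: mult.commute)
    qed
    then show "(1 - q n) * exp (?a n * t) \<le> ?z n t" by (simp add: h_0 exp_minus exp_diff field_simps)
    have "exp (- ?b n * t) * ?z n t \<le> exp (- ?b n * 0) * ?z n 0"
    proof (rule DERIV_nonpos_imp_decreasing_open[OF assms(2)])
      show "continuous_on {0..t} (\<lambda>s. exp (- ?b n * s) * ?z n s)" by (intro continuous_intros cont)
      fix s assume s: "0 < s" "s < t"
      have "gen_fun (P n) (h n s) - gen_fun (P n) (q n) \<le> ?z n s * gen_fun (diffs (P n)) (h n s)"
        using hs[of s] s q(1)[of n] by (intro gen_fun_diff_bounds(2)[OF P_nonneg P_summable]) auto
      also have "\<dots> \<le> ?z n s * gen_fun (diffs (P n)) 1"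
        using hs[of s] s q(1)[of n] s1
        by (intro mult_left_mono gen_fun_mono diffs_nonneg P_nonneg diffs_summable[OF P_summable]) auto
      finally show "\<exists>y. ((\<lambda>s. exp (- ?b n * s) * ?z n s) has_real_derivative y) (at s) \<and> y \<le> 0"
        by - (rule exI, rule conjI, rule D[OF s], simp add: mult.commute mult_le_0_iff)
    qed
    then show "?z n t \<le> (1 - q n) * exp (?b n * t)" by (simp add: h_0 exp_minus exp_diff field_simps)
  qed
  have a: "(\<lambda>n. exp (?a n * t)) \<longlonglongrightarrow> exp ((m1 - 1) * t)"
    by (intro tendsto_intros diffs_tendsto q_tendsto_1 assms q)
  have b: "(\<lambda>n. exp (?b n * t)) \<longlonglongrightarrow> exp ((m1 - 1) * t)"
    using diffs_tendsto[of "\<lambda>_. 1"] by (intro tendsto_intros) auto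
  have "(\<lambda>n. ?z n t / (1 - q n)) \<longlonglongrightarrow> exp ((m1 - 1) * t)"
    by (rule tendsto_sandwich[OF _ _ a b])
       (use bounds q(2) in \<open>auto intro!: always_eventually simp: pos_le_divide_eq pos_divide_le_eq mult.commute\<close>)
  then have "(\<lambda>n. 1 - ?z n t / (1 - q n)) \<longlonglongrightarrow> 1 - exp ((m1 - 1) * t)" by (intro tendsto_intros)
  moreover have "1 - ?z n t / (1 - q n) = (1 - h n t) / (1 - q n)" for n
    using q(2)[of n] by (simp add: field_simps)
  ultimately show ?thesis by (simp add: algebra_simps)
qed

end

section \<open>The limit law\<close>

locale supercritical_gen_fun =
  fixes f :: "nat \<Rightarrow> real" and R q :: real
  assumes f: "\<And>k. 0 \<le> f k" "summable (\<lambda>k. f k * R ^ k)" and R: "1 < R"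
    and f_1: "gen_fun f 1 = 1" and q: "0 \<le> q" "q < 1" "gen_fun f q = q"
    and supercritical: "1 < gen_fun (diffs f) 1"
begin

abbreviation \<phi> :: "real \<Rightarrow> real" where "\<phi> x \<equiv> tail_gen_fun f [q, 1, x]"
abbreviation \<phi>2 :: "real \<Rightarrow> real" where "\<phi>2 x \<equiv> tail_gen_fun f [q, 1, 1, x]"
abbreviation m :: real where "m \<equiv> gen_fun (diffs f) 1"

definition \<psi> :: "real \<Rightarrow> real" where
  "\<psi> x = \<phi>2 x / \<phi> x + (m - 1) / ((1 - q) * (x - q) * \<phi> x)"

lemma \<phi>_pos: "0 < x \<Longrightarrow> x \<le> 1 \<Longrightarrow> 0 < \<phi> x"
  using phi_pos[OF f R f_1 q] supercritical by simp

lemma \<phi>_eq: "0 \<le> x \<Longrightarrow> x \<le> 1 \<Longrightarrow> (x - 1) * (x - q) * \<phi> x = gen_fun f x - x"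
  using phi_factorization[OF f R f_1 q] by simp

lemma \<phi>_1: "(1 - q) * \<phi> 1 = m - 1"
  using phi_1[OF f R f_1 q] by simp

lemma f_less_id: "q < x \<Longrightarrow> x < 1 \<Longrightarrow> gen_fun f x < x"
  using \<phi>_eq[of x] \<phi>_pos[of x] q mult_neg_pos[of "(x - 1) * (x - q)" "\<phi> x"]
  by (simp add: mult_neg_pos)

lemma f_greater_id: "0 < x \<Longrightarrow> x < q \<Longrightarrow> x < gen_fun f x"
  using \<phi>_eq[of x] \<phi>_pos[of x] q mult_pos_pos[of "(x - 1) * (x - q)" "\<phi> x"]
  by (simp add: mult_neg_neg)

text \<open>\<open>(m - 1) / (1 - q)\<close> is \<open>\<phi> 1\<close>, which dominates
  \<open>\<phi> x\<close>. Beyond positivity, the non-integrable pole of the bound at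
  \<open>q\<close> makes \<open>U\<close> unbounded there.\<close>

lemma \<psi>_ge:
  assumes "q < x" "x \<le> 1"
  shows "1 / (x - q) \<le> \<psi> x"
proof -
  have x: "0 \<le> x" "0 < x" using assms q by auto
  have "1 / (x - q) = \<phi> 1 / ((x - q) * \<phi> 1)" using \<phi>_pos[of 1] by simp
  also have "\<dots> \<le> \<phi> 1 / ((x - q) * \<phi> x)"
    using assms phi_le[OF f R f_1 q x(1) assms(2)] \<phi>_pos[of x] \<phi>_pos[of 1] x
    by (intro divide_left_mono mult_left_mono mult_pos_pos) auto
  also have "\<dots> = (m - 1) / ((1 - q) * (x - q) * \<phi> x)"
    using q \<phi>_pos[of x] x assms by (simp flip: \<phi>_1)
  also have "\<dots> \<le> \<psi> x"
    unfolding \<psi>_def using phi2_nonneg[OF f R f_1 q x(1)] \<phi>_pos[of x] x assms by simp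
  finally show ?thesis .
qed

lemma \<psi>_pos: "q < x \<Longrightarrow> x \<le> 1 \<Longrightarrow> 0 < \<psi> x"
  using \<psi>_ge[of x] by (meson diff_gt_0_iff_gt less_le_trans zero_less_divide_1_iff)

text \<open>Removal of the pole at \<open>1\<close>: the identity
  \<open>(1 - q) * \<phi> 1 = m - 1\<close> says that \<open>(m - 1) / (x - f(x))\<close> is
  singular there like \<open>1 / (1 - x)\<close>, and \<open>\<psi>\<close> is what remains.\<close>

lemma \<psi>_eq:
  assumes "q < x" "x < 1"
  shows "\<psi> x = (m - 1) / (x - gen_fun f x) - 1 / (1 - x)"
proof -
  have x: "0 \<le> x" "0 < x" using assms q by auto
  have pos: "0 < \<phi> x" using \<phi>_pos x assms by simp
  have "(1 - x) * \<phi>2 x = \<phi> 1 - \<phi> x"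
    using phi2_difference[OF f R f_1 q x(1)] assms by (simp add: algebra_simps)
  then have 1: "\<phi>2 x = (\<phi> 1 - \<phi> x) / (1 - x)" using assms by (simp add: field_simps)
  have 2: "x - gen_fun f x = (1 - x) * (x - q) * \<phi> x" using \<phi>_eq[OF x(1)] assms by (simp add: algebra_simps)
  show ?thesis
    unfolding \<psi>_def 1 2 \<phi>_1[symmetric] using pos assms q
    by (simp add: divide_simps) (simp add: algebra_simps)
qed

lemma \<psi>_continuous_on: "q < y \<Longrightarrow> continuous_on {y..1} \<psi>"
  unfolding \<psi>_def using q \<phi>_pos
  by (intro continuous_intros continuous_on_subset[OF phi_continuous_on[OF f R f_1 q]]
      continuous_on_subset[OF phi2_continuous_on[OF f R f_1 q]]) (auto simp: less_imp_neq[symmetric])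

lemma \<psi>_integrable_on: "q < y \<Longrightarrow> \<psi> integrable_on {y..1}"
  by (intro integrable_continuous_interval \<psi>_continuous_on)

text \<open>The inverse of the limit law, in the coordinate \<open>y = 1 - (1 - q) \<Phi>(u)\<close>.\<close>

definition U :: "real \<Rightarrow> real" where
  "U y = ln ((1 - y) / (1 - q)) + integral {y..1} \<psi>"

lemma U_strict_antimono:
  assumes "q < x" "x < y" "y < 1"
  shows "U y < U x"
proof -
  have "integral {x..1} \<psi> = integral {x..y} \<psi> + integral {y..1} \<psi>"
    using Henstock_Kurzweil_Integration.integral_combine[of x y 1 \<psi>] \<psi>_integrable_on[of x] assms by simp
  moreover have "0 \<le> integral {x..y} \<psi>"
    using assms \<psi>_pos by (intro integral_nonneg integrable_subinterval_real[OF \<psi>_integrable_on[of x]])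
      (auto intro: less_imp_le)
  moreover have "ln ((1 - y) / (1 - q)) < ln ((1 - x) / (1 - q))"
    using assms by (subst ln_less_cancel_iff) (auto simp: divide_strict_right_mono)
  ultimately show ?thesis by (simp add: U_def)
qed

lemma U_le_iff: "x \<in> {q<..<1} \<Longrightarrow> y \<in> {q<..<1} \<Longrightarrow> U x \<le> U y \<longleftrightarrow> y \<le> x"
  using U_strict_antimono[of x y] U_strict_antimono[of y x] by (cases x y rule: linorder_cases) auto

lemma U_continuous_on: "continuous_on {q<..<1} U"
proof (rule continuous_at_imp_continuous_on, safe)
  fix x assume x: "x \<in> {q<..<1}"
  obtain a where a: "q < a" "a < x" using dense[of q x] x by auto
  have "continuous_on {a..1} (\<lambda>y. integral {y..1} \<psi>)"
    by (rule indefinite_integral_continuous_1'[OF \<psi>_integrable_on[OF a(1)]])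
  then have "continuous_on {a<..<1} (\<lambda>y. integral {y..1} \<psi>)" by (rule continuous_on_subset) auto
  then have "isCont (\<lambda>y. integral {y..1} \<psi>) x"
    using a x by (simp add: continuous_on_eq_continuous_at)
  then show "isCont U x"
    unfolding U_def using x q by (intro continuous_intros) auto
qed

lemma U_surj: obtains y where "q < y" "y < 1" "U y = u"
proof -
  define y0 where "y0 = (1 + q) / 2"
  \<comment> \<open>Solves \<open>(1 - a) / (a - q) = exp u\<close>; by \<open>\<psi>_ge\<close> the
    logarithm of the left-hand side is a lower bound for \<open>U a\<close>.\<close>
  define a where "a = q + (1 - q) / (1 + exp u)"
  define I where "I = integral {y0..1} \<psi>"
  \<comment> \<open>With \<open>(1 - b) / (1 - q) = d\<close> the logarithmic term of
    \<open>U b\<close> is at most \<open>u - I\<close>; the cap \<open>1 / 2\<close> keeps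
    \<open>b \<ge> y0\<close>, so that the integral term is at most \<open>I\<close>.\<close>
  define d where "d = min (1 / 2) (exp (u - I))"
  define b where "b = 1 - (1 - q) * d"
  have y0: "q < y0" "y0 < 1" using q by (auto simp: y0_def)
  have e1: "0 < 1 + exp u" by (simp add: add_pos_pos)
  have a: "q < a" "a < 1" using q e1 by (auto simp: a_def field_simps)
  have d: "0 < d" "d \<le> 1 / 2" "d \<le> exp (u - I)" by (auto simp: d_def)
  have "(1 - q) * d \<le> (1 - q) * (1 / 2)" using d q by (intro mult_left_mono) auto
  then have b: "y0 \<le> b" "b < 1" using d q by (auto simp: b_def y0_def field_simps)
  have "(1 - b) / (1 - q) = d" using q by (simp add: b_def)
  moreover have "ln d \<le> u - I" using d by (metis exp_gt_zero ln_exp ln_le_cancel_iff)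
  moreover have "integral {b..1} \<psi> \<le> I"
    unfolding I_def using y0 b \<psi>_pos
    by (intro integral_subset_le \<psi>_integrable_on) (auto intro: less_imp_le)
  ultimately have Ub: "U b \<le> u" by (simp add: U_def)
  have "((\<lambda>x. 1 / (x - q)) has_integral (ln (1 - q) - ln (a - q))) {a..1}"
    using a by (intro fundamental_theorem_of_calculus)
      (auto intro!: derivative_eq_intros simp flip: has_real_derivative_iff_has_vector_derivative)
  then have "ln (1 - q) - ln (a - q) \<le> integral {a..1} \<psi>"
    using a \<psi>_ge by (intro has_integral_le[OF _ integrable_integral[OF \<psi>_integrable_on]]) auto
  moreover have "ln ((1 - a) / (1 - q)) + (ln (1 - q) - ln (a - q)) = ln ((1 - a) / (a - q))"
    using a q by (simp add: ln_div)
  moreover have "(1 - a) / (a - q) = exp u"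
  proof -
    have "1 - a = exp u * (a - q)" using e1 by (simp add: a_def field_simps)
    then show ?thesis using a by simp
  qed
  ultimately have Ua: "u \<le> U a" by (simp add: U_def)
  have "a \<le> b"
  proof (rule ccontr)
    assume "\<not> ?thesis"
    then have "U a < U b" using U_strict_antimono[of b a] a b y0 by auto
    with Ua Ub show False by simp
  qed
  moreover have "continuous_on {a..b} U"
    by (rule continuous_on_subset[OF U_continuous_on]) (use a b in auto)
  ultimately obtain y where "a \<le> y" "y \<le> b" "U y = u" using IVT2'[of U b u a] Ua Ub by auto
  then show ?thesis using that[of y] a b by auto
qed

text \<open>A pushforward, so that the limit is a distribution function by construction: as
  \<open>U\<close> decreases, \<open>U Y \<le> U y\<close> means \<open>Y \<ge> y\<close>. The
  indicator makes the map Borel on the whole line; the uniform measure does not see the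
  complement.\<close>

definition limit_law :: "real measure" where
  "limit_law = distr (uniform_measure lborel {q<..<1}) borel (\<lambda>y. indicator {q<..<1} y * U y)"

lemma U_measurable: "(\<lambda>y. indicator {q<..<1} y * U y) \<in> borel_measurable borel"
  using borel_measurable_continuous_on_indicator[OF _ U_continuous_on] by simp

lemma real_distribution_limit_law: "real_distribution limit_law"
proof -
  interpret prob_space "uniform_measure lborel {q<..<1}"
    by (rule prob_space_uniform_measure) (use q in auto)
  show ?thesis unfolding limit_law_def by (rule real_distribution_distr) (use U_measurable in simp)
qed

lemma cdf_limit_law:
  assumes "q < y" "y < 1"
  shows "cdf limit_law (U y) = (1 - y) / (1 - q)"
proof -
  let ?V = "\<lambda>y. indicator {q<..<1} y * U y"
  have "cdf limit_law (U y) = measure (uniform_measure lborel {q<..<1}) (?V -` {..U y})"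
    unfolding cdf_def limit_law_def using U_measurable by (subst measure_distr) auto
  also have "\<dots> = measure lborel ({q<..<1} \<inter> ?V -` {..U y}) / measure lborel {q<..<1}"
    using q measurable_sets[OF U_measurable, of "{..U y}"] by (subst measure_uniform_measure) auto
  also have "{q<..<1} \<inter> ?V -` {..U y} = {y..<1}"
    using assms U_le_iff[of _ y] by auto
  finally show ?thesis using assms q by simp
qed

end

section \<open>The supercritical limit\<close>

locale supercritical_sequence = offspring_sequence P f s0 q r h + limit: supercritical_gen_fun f s0 q0
  for P f s0 q r h q0
begin

lemma m1_gt: "1 < m1"
  by (rule limit.supercritical)

text \<open>The tangent of \<open>f\<close> at \<open>1\<close> has slope above \<open>1\<close>, so
  \<open>f\<close> exceeds the diagonal just to the right of \<open>1\<close>, which traps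
  \<open>r n\<close>.\<close>

lemma r_tendsto: "r \<longlonglongrightarrow> 1"
proof (rule order_tendstoI)
  fix a :: real assume "1 < a"
  define x where "x = min a s0"
  have x: "1 < x" "x \<le> s0" "x \<le> a" using \<open>1 < a\<close> s0 by (auto simp: x_def)
  have "(x - 1) * 1 < (x - 1) * m1" using x m1_gt by (intro mult_strict_left_mono) auto
  then have "x < 1 + (x - 1) * m1" by simp
  also have "\<dots> \<le> gen_fun f x" by (rule f_tangent) (use x in auto)
  finally have "x < gen_fun f x" .
  from r_less_eventually[OF x(1,2) this] show "eventually (\<lambda>n. r n < a) sequentially"
    by eventually_elim (use x in simp)
qed (use r(1) in \<open>auto intro!: always_eventually intro: less_trans\<close>)

lemma q_tendsto: "q \<longlonglongrightarrow> q0"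
proof (rule order_tendstoI)
  fix a assume "q0 < a"
  then obtain x where x: "q0 < x" "x < min a 1" using dense[of q0 "min a 1"] limit.q by auto
  have "eventually (\<lambda>n. q n < x) sequentially"
    using limit.q x by (intro q_less_eventually limit.f_less_id) auto
  then show "eventually (\<lambda>n. q n < a) sequentially" by eventually_elim (use x in simp)
next
  fix a assume a: "a < q0"
  show "eventually (\<lambda>n. a < q n) sequentially"
  proof (cases "a < 0")
    case True
    then show ?thesis using q(1) by (auto intro!: always_eventually intro: less_le_trans)
  next
    case False
    obtain x where x: "a < x" "x < q0" using dense[OF a] by auto
    have "eventually (\<lambda>n. x < q n) sequentially"
      using limit.q x False by (intro q_gt_eventually limit.f_greater_id) auto
    then show ?thesis by eventually_elim (use x in simp)
  qed
qed

definition \<beta> :: "nat \<Rightarrow> real" where "\<beta> n = gen_fun (diffs (P n)) (r n) - 1"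

lemma \<beta>_tendsto: "\<beta> \<longlonglongrightarrow> m1 - 1"
  unfolding \<beta>_def using r(1) by (intro tendsto_intros diffs_tendsto r_tendsto) (auto intro: less_imp_le less_trans[OF zero_less_one])

text \<open>\<open>W n y\<close> is the time at which \<open>h n\<close> passes the level \<open>y\<close>.\<close>

definition W :: "nat \<Rightarrow> real \<Rightarrow> real" where
  "W n y = integral {y..1} (\<lambda>x. 1 / (x - gen_fun (P n) x))"

lemma W_integrand_continuous_on:
  assumes "q n < y"
  shows "continuous_on {y..1} (\<lambda>x. 1 / (x - gen_fun (P n) x))"
proof -
  have "gen_fun (P n) x < x" if "x \<in> {y..1}" for x
    using P_less_id[of n x] that assms r(1)[of n] by auto
  moreover have "continuous_on {y..1} (gen_fun (P n))"
    by (rule gen_fun_continuous_on[OF P_summable[of n]]) (use assms q(1)[of n] s0 in auto)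
  ultimately show ?thesis by (intro continuous_intros) (auto simp: less_imp_neq[symmetric])
qed

lemma W_antimono:
  assumes "q n < x" "x \<le> y" "y \<le> 1"
  shows "W n y \<le> W n x"
proof -
  have "0 \<le> 1 / (z - gen_fun (P n) z)" if "z \<in> {x..1}" for z
    using P_less_id[of n z] that assms r(1)[of n] by auto
  then show ?thesis unfolding W_def using assms
    by (intro integral_subset_le integrable_continuous_interval W_integrand_continuous_on) auto
qed

text \<open>Separation of variables: by the differential equation \<open>W n (h n s) - s\<close> has
  derivative zero, and it vanishes at \<open>s = 0\<close>.\<close>

lemma W_h:
  assumes "0 \<le> t"
  shows "W n (h n t) = t"
proof -
  let ?G = "\<lambda>x. 1 / (x - gen_fun (P n) x)"
  have K: "((\<lambda>s. W n (h n s) - s) has_real_derivative 0) (at s within {0..t})" if s: "s \<in> {0..t}" for s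
  proof -
    have sub: "h n ` {0..t} \<subseteq> {h n t..1}" using h_mono h_le by auto
    \<comment> \<open>At \<open>s = 0\<close> the level is the endpoint \<open>1\<close>, so the
      derivative is taken within the interval.\<close>
    have "(W n has_real_derivative - ?G (h n s)) (at (h n s) within {h n t..1})"
      unfolding W_def using sub s
      by (intro integral_has_real_derivative' W_integrand_continuous_on h_gt assms) (auto intro: h_mono h_le)
    then have "(W n has_real_derivative - ?G (h n s)) (at (h n s) within h n ` {0..t})"
      using sub by (rule has_field_derivative_subset)
    from DERIV_image_chain[OF this h_ODE[OF s]]
    have "((\<lambda>s. W n (h n s)) has_real_derivative - ?G (h n s) * (gen_fun (P n) (h n s) - h n s)) (at s within {0..t})"
      by (simp add: comp_def)
    moreover have "gen_fun (P n) (h n s) < h n s"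
      using P_less_id[of n "h n s"] h_gt[of s n] h_le[of n s] r(1)[of n] s by auto
    then have "- ?G (h n s) * (gen_fun (P n) (h n s) - h n s) = 1" by (simp add: field_simps)
    ultimately have "((\<lambda>s. W n (h n s)) has_real_derivative 1) (at s within {0..t})" by simp
    from DERIV_diff[OF this DERIV_ident] show ?thesis by simp
  qed
  obtain c where c: "\<forall>s\<in>{0..t}. W n (h n s) - s = c"
    using has_field_derivative_zero_constant[OF convex_real_interval(5) K] by blast
  have "W n (h n 0) = 0" by (simp add: h_0 W_def)
  with c assms have "c = 0" by force
  with c assms show ?thesis by force
qed

lemma h_gt_level:
  assumes "0 \<le> t" "y \<le> 1" "t < W n y"
  shows "y < h n t"
proof (rule ccontr)
  assume "\<not> ?thesis"
  then have "W n y \<le> W n (h n t)" using assms h_gt by (intro W_antimono) auto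
  then show False using W_h[OF assms(1), of n] assms(3) by simp
qed

lemma h_less_level:
  assumes "0 \<le> t" "q n < y" "W n y < t"
  shows "h n t < y"
proof (rule ccontr)
  assume "\<not> ?thesis"
  then have "W n (h n t) \<le> W n y" using assms h_le by (intro W_antimono) auto
  then show False using W_h[OF assms(1), of n] assms(3) by simp
qed

text \<open>Subtracting the linearization at \<open>r n\<close> makes the integrand of \<open>W\<close> bounded up to \<open>x = 1\<close>,
  uniformly in \<open>n\<close>.\<close>

definition remainder :: "nat \<Rightarrow> real \<Rightarrow> real" where
  "remainder n x = 1 / (x - gen_fun (P n) x) - 1 / (\<beta> n * (r n - x))"

text \<open>The linearized integrand has primitive \<open>- ln (r n - x) / \<beta> n\<close>, whose
  value at \<open>x = 1\<close> carries the divergence and is moved to the left-hand side.\<close>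

lemma W_eq_remainder:
  assumes "q n < y" "y \<le> 1" "0 < \<beta> n"
  shows "remainder n integrable_on {y..1}"
    and "W n y + ln (r n - 1) / \<beta> n = integral {y..1} (remainder n) + ln (r n - y) / \<beta> n"
proof -
  have 1: "((\<lambda>x. 1 / (x - gen_fun (P n) x)) has_integral W n y) {y..1}"
    unfolding W_def by (intro integrable_integral integrable_continuous_interval W_integrand_continuous_on assms)
  have 2: "((\<lambda>x. 1 / (\<beta> n * (r n - x))) has_integral ((- ln (r n - 1) / \<beta> n) - (- ln (r n - y) / \<beta> n))) {y..1}"
    using assms r(1)[of n]
    by (intro fundamental_theorem_of_calculus)
      (auto intro!: derivative_eq_intros simp: field_simps simp flip: has_real_derivative_iff_has_vector_derivative)
  from has_integral_diff[OF 1 2] have "(remainder n has_integral (W n y - ((- ln (r n - 1) / \<beta> n) - (- ln (r n - y) / \<beta> n)))) {y..1}"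
    unfolding remainder_def .
  then show "remainder n integrable_on {y..1}"
    and "W n y + ln (r n - 1) / \<beta> n = integral {y..1} (remainder n) + ln (r n - y) / \<beta> n"
    by (auto simp: has_integral_iff)
qed

text \<open>With \<open>a = x - f(x)\<close> and \<open>d = r - x\<close> the remainder is
  \<open>(\<beta> d - a) / (a \<beta> d)\<close>. The numerator is the Taylor error at
  \<open>r\<close>, at most \<open>B d^2\<close>, and the chord from \<open>y\<close> to
  \<open>r\<close> gives \<open>a \<ge> \<delta> d / s1\<close>, so all powers of \<open>d\<close>
  cancel.\<close>

lemma remainder_bound:
  assumes B: "\<And>x. 0 \<le> x \<Longrightarrow> x \<le> s1 \<Longrightarrow> gen_fun (diffs (diffs (P n))) x \<le> B"
    and \<delta>: "0 < \<delta>" "\<delta> \<le> y - gen_fun (P n) y" and c: "0 < c" "c \<le> \<beta> n" and rn: "r n < s1"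
    and x: "q n < y" "y \<le> x" "x \<le> 1"
  shows "\<bar>remainder n x\<bar> \<le> B * s1 / (\<delta> * c)"
proof -
  define a d where "a = x - gen_fun (P n) x" and "d = r n - x"
  have q0: "0 \<le> q n" by (rule q)
  have a: "0 < a" unfolding a_def using P_less_id[of n x] x r(1)[of n] by auto
  have d: "0 < d" "d \<le> r n - y" using x r(1)[of n] by (auto simp: d_def)
  have B0: "0 \<le> B"
  proof -
    have "0 \<le> gen_fun (diffs (diffs (P n))) 0"
      by (intro gen_fun_nonneg diffs_nonneg P_nonneg diffs_summable[OF diffs_P_summable]) (use s1 in auto)
    also have "\<dots> \<le> B" using s1 by (intro B) auto
    finally show ?thesis .
  qed
  have "(r n - y) * (gen_fun (P n) x - x) \<le> (r n - x) * (gen_fun (P n) y - y) + (x - y) * (gen_fun (P n) (r n) - r n)"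
    using x q0 r(1)[of n] rn s1 by (intro gen_fun_chord[OF P_nonneg P_summable]) auto
  then have "d * (y - gen_fun (P n) y) \<le> (r n - y) * a"
    unfolding a_def d_def r(3) by (simp add: algebra_simps)
  moreover have "d * \<delta> \<le> d * (y - gen_fun (P n) y)" using d \<delta> by (intro mult_left_mono) auto
  moreover have "(r n - y) * a \<le> s1 * a" using x q0 rn a by (intro mult_right_mono) auto
  ultimately have da: "d * \<delta> \<le> s1 * a" by linarith
  \<comment> \<open>The tangent at \<open>r n\<close> has slope \<open>\<beta> n + 1\<close>; lying
    above it makes the numerator nonnegative.\<close>
  have "gen_fun (P n) (r n) + (x - r n) * gen_fun (diffs (P n)) (r n) \<le> gen_fun (P n) x"
    using x q0 r(1)[of n] rn s1 by (intro gen_fun_tangent[OF P_nonneg P_summable]) auto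
  then have N0: "0 \<le> \<beta> n * d - a" unfolding a_def d_def \<beta>_def r(3) by (simp add: algebra_simps)
  have "(r n - x) * gen_fun (diffs (P n)) x \<le> gen_fun (P n) (r n) - gen_fun (P n) x"
    using x q0 r(1)[of n] rn s1 by (intro gen_fun_diff_bounds(1)[OF P_nonneg P_summable]) auto
  then have "\<beta> n * d - a \<le> d * (gen_fun (diffs (P n)) (r n) - gen_fun (diffs (P n)) x)"
    unfolding a_def d_def \<beta>_def r(3) by (simp add: algebra_simps)
  also have "gen_fun (diffs (P n)) (r n) - gen_fun (diffs (P n)) x \<le> (r n - x) * gen_fun (diffs (diffs (P n))) (r n)"
    using x q0 r(1)[of n] rn s1
    by (intro gen_fun_diff_bounds(2)[OF diffs_nonneg[OF P_nonneg] diffs_P_summable]) auto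
  also have "\<dots> \<le> d * B"
    unfolding d_def using x r(1)[of n] rn by (intro mult_left_mono B) auto
  finally have N: "\<beta> n * d - a \<le> d * (d * B)" using d by simp
  have b: "0 < \<beta> n" using c by simp
  have eq: "remainder n x = (\<beta> n * d - a) / (a * (\<beta> n * d))"
    unfolding remainder_def a_def[symmetric] d_def[symmetric] using a b d by (simp add: field_simps)
  have "(\<beta> n * d - a) / (a * (\<beta> n * d)) \<le> (d * (d * B)) / (a * (\<beta> n * d))"
    using N a b d by (intro divide_right_mono) auto
  also have "\<dots> = B * (d / a) / \<beta> n" using a b d by (simp add: field_simps)
  also have "\<dots> \<le> B * (s1 / \<delta>) / \<beta> n"
    using da a \<delta> b B0 by (intro divide_right_mono mult_left_mono) (auto simp: field_simps)
  also have "\<dots> \<le> B * (s1 / \<delta>) / c"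
  proof (rule divide_left_mono)
    show "0 \<le> B * (s1 / \<delta>)" using B0 s1 \<delta> by simp
  qed (use c b in auto)
  also have "\<dots> = B * s1 / (\<delta> * c)" by simp
  finally show ?thesis unfolding eq using N0 a b d by (subst abs_of_nonneg) (auto intro!: divide_nonneg_nonneg)
qed

lemma remainder_tendsto:
  assumes "q0 < x" "x < 1"
  shows "(\<lambda>n. remainder n x) \<longlonglongrightarrow> limit.\<psi> x / (m1 - 1)"
proof -
  have "(\<lambda>n. remainder n x) \<longlonglongrightarrow> 1 / (x - gen_fun f x) - 1 / ((m1 - 1) * (1 - x))"
    unfolding remainder_def using assms limit.f_less_id[OF assms] limit.q s0 m1_gt
    by (intro tendsto_intros P_tendsto \<beta>_tendsto r_tendsto) auto
  moreover have "1 / (x - gen_fun f x) - 1 / ((m1 - 1) * (1 - x)) = limit.\<psi> x / (m1 - 1)"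
  proof -
    have "1 / a - 1 / (c * d) = (c / a - 1 / d) / c" if "c \<noteq> 0" for a c d :: real
      using that by (simp add: diff_divide_distrib mult.commute)
    then show ?thesis unfolding limit.\<psi>_eq[OF assms] using m1_gt by simp
  qed
  ultimately show ?thesis by simp
qed

lemma W_tendsto:
  assumes y: "q0 < y" "y < 1"
  shows "(\<lambda>n. W n y + ln (r n - 1) / \<beta> n) \<longlonglongrightarrow> (ln (1 - y) + integral {y..1} limit.\<psi>) / (m1 - 1)"
proof -
  obtain B where B: "0 \<le> B" "\<And>n x. 0 \<le> x \<Longrightarrow> x \<le> s1 \<Longrightarrow> gen_fun (diffs (diffs (P n))) x \<le> B"
    by (rule bounded_second_derivatives) blast
  \<comment> \<open>Half of the limiting gap at \<open>y\<close>, and below half of the limit of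
    \<open>\<beta>\<close>: both lower bounds then hold for all large \<open>n\<close>.\<close>
  define \<delta> where "\<delta> = (y - gen_fun f y) / 2"
  define c where "c = (m1 - 1) / 2"
  have \<delta>: "0 < \<delta>" "gen_fun f y < y - \<delta>" using limit.f_less_id[OF y] by (auto simp: \<delta>_def field_simps)
  have c: "0 < c" "c < m1 - 1" using m1_gt by (auto simp: c_def)
  have "eventually (\<lambda>n. q n < y \<and> r n < s1 \<and> c < \<beta> n \<and> gen_fun (P n) y < y - \<delta>) sequentially"
    using order_tendstoD(2)[OF q_tendsto y(1)] order_tendstoD(2)[OF r_tendsto s1(1)]
      order_tendstoD(1)[OF \<beta>_tendsto c(2)] order_tendstoD(2)[OF P_tendsto \<delta>(2)] y limit.q s0
    by (auto intro!: eventually_conj)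
  then obtain n0 where n0: "\<And>n. n \<ge> n0 \<Longrightarrow> q n < y \<and> r n < s1 \<and> c < \<beta> n \<and> gen_fun (P n) y < y - \<delta>"
    unfolding eventually_sequentially by blast
  let ?g = "\<lambda>x. limit.\<psi> x / (m1 - 1)"
  \<comment> \<open>Pointwise convergence is known only for \<open>x < 1\<close>; the single point
    \<open>1\<close> is given the intended limit, and the shift by \<open>n0\<close> makes the
    bounds valid for every index.\<close>
  let ?R = "\<lambda>n x. if x = 1 then ?g 1 else remainder (n + n0) x"
  have int: "remainder (n + n0) integrable_on {y..1}" for n
    using n0[of "n + n0"] c y by (intro W_eq_remainder(1)) auto
  have "(\<lambda>n. integral {y..1} (?R n)) \<longlonglongrightarrow> integral {y..1} ?g"
  proof (rule dominated_convergence(2))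
    show "?R n integrable_on {y..1}" for n
      by (rule integrable_spike[OF int, of "{1}"]) auto
    show "(\<lambda>_. max \<bar>?g 1\<bar> (B * s1 / (\<delta> * c))) integrable_on {y..1}" by (rule integrable_const_ivl)
    show "norm (?R n x) \<le> max \<bar>?g 1\<bar> (B * s1 / (\<delta> * c))" if "x \<in> {y..1}" for n x
      using that n0[of "n + n0"] remainder_bound[OF B(2) \<delta>(1) _ c(1), where n = "n + n0" and y = y and x = x] by (auto simp: le_max_iff_disj)
    show "(\<lambda>n. ?R n x) \<longlonglongrightarrow> ?g x" if "x \<in> {y..1}" for x
      using that remainder_tendsto[of x, THEN LIMSEQ_ignore_initial_segment, of n0] y
      by (cases "x = 1") auto
  qed
  moreover have "integral {y..1} (?R n) = integral {y..1} (remainder (n + n0))" for n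
    by (rule integral_spike[of "{1}"]) auto
  ultimately have "(\<lambda>n. integral {y..1} (remainder (n + n0))) \<longlonglongrightarrow> integral {y..1} ?g" by simp
  then have "(\<lambda>n. integral {y..1} (remainder n)) \<longlonglongrightarrow> integral {y..1} ?g" by (rule LIMSEQ_offset)
  moreover have "(\<lambda>n. ln (r n - y) / \<beta> n) \<longlonglongrightarrow> ln (1 - y) / (m1 - 1)"
    using y m1_gt by (intro tendsto_intros r_tendsto \<beta>_tendsto) auto
  ultimately have "(\<lambda>n. integral {y..1} (remainder n) + ln (r n - y) / \<beta> n)
      \<longlonglongrightarrow> integral {y..1} ?g + ln (1 - y) / (m1 - 1)"
    by (rule tendsto_add)
  also have "integral {y..1} ?g + ln (1 - y) / (m1 - 1) = (ln (1 - y) + integral {y..1} limit.\<psi>) / (m1 - 1)"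
    by (simp add: add_divide_distrib)
  finally show ?thesis
  proof (rule Lim_transform_eventually)
    show "eventually (\<lambda>n. integral {y..1} (remainder n) + ln (r n - y) / \<beta> n = W n y + ln (r n - 1) / \<beta> n) sequentially"
      unfolding eventually_sequentially
      by (intro exI[of _ n0] allI impI W_eq_remainder(2)[symmetric]) (use n0 c y in force)+
  qed
qed

section \<open>Centring at the time scale of the theorem\<close>

definition T :: "real \<Rightarrow> nat \<Rightarrow> real" where
  "T u n = ln (inverse (r n - 1)) / \<beta> n + (ln (1 - q0) + u) / (m1 - 1)"

text \<open>The formula for the conditional probability is available only for
  \<open>t \<ge> 0\<close>; the diverging logarithm outweighs the constant for every
  \<open>u\<close>.\<close>

lemma T_nonneg_eventually: "eventually (\<lambda>n. 0 \<le> T u n) sequentially"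
proof -
  let ?c = "(ln (1 - q0) + u) / (m1 - 1)"
  have "eventually (\<lambda>n. r n < 1 + exp (- m1 * \<bar>?c\<bar>) \<and> 0 < \<beta> n \<and> \<beta> n < m1) sequentially"
    using m1_gt by (intro eventually_conj order_tendstoD[OF r_tendsto] order_tendstoD[OF \<beta>_tendsto]) auto
  then show ?thesis
  proof eventually_elim
    case (elim n)
    have "\<beta> n * \<bar>?c\<bar> \<le> m1 * \<bar>?c\<bar>" using elim by (intro mult_right_mono) auto
    also have "\<dots> \<le> ln (inverse (r n - 1))"
    proof -
      have "ln (r n - 1) \<le> ln (exp (- m1 * \<bar>?c\<bar>))"
        using elim r(1)[of n] by (subst ln_le_cancel_iff) auto
      then show ?thesis using r(1)[of n] by (simp add: ln_inverse)
    qed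
    finally have "\<bar>?c\<bar> \<le> ln (inverse (r n - 1)) / \<beta> n" using elim by (simp add: pos_le_divide_eq mult.commute)
    then show ?case unfolding T_def by linarith
  qed
qed

lemma W_minus_T_tendsto:
  assumes y: "q0 < y" "y < 1"
  shows "(\<lambda>n. W n y - T u n) \<longlonglongrightarrow> (limit.U y - u) / (m1 - 1)"
proof -
  have "(\<lambda>n. W n y + ln (r n - 1) / \<beta> n - (ln (1 - q0) + u) / (m1 - 1))
      \<longlonglongrightarrow> (ln (1 - y) + integral {y..1} limit.\<psi>) / (m1 - 1) - (ln (1 - q0) + u) / (m1 - 1)"
    by (intro tendsto_intros W_tendsto y)
  moreover have "W n y + ln (r n - 1) / \<beta> n - (ln (1 - q0) + u) / (m1 - 1) = W n y - T u n" for n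
    unfolding T_def using r(1)[of n] by (simp add: ln_inverse)
  moreover have "(ln (1 - y) + integral {y..1} limit.\<psi>) / (m1 - 1) - (ln (1 - q0) + u) / (m1 - 1) = (limit.U y - u) / (m1 - 1)"
  proof -
    have "ln ((1 - y) / (1 - q0)) = ln (1 - y) - ln (1 - q0)" by (subst ln_div) (use y limit.q in auto)
    then show ?thesis unfolding limit.U_def by (simp only: diff_divide_distrib add_divide_distrib)
  qed
  ultimately show ?thesis by simp
qed

text \<open>Bracketing: \<open>U\<close> is strictly decreasing, so levels below \<open>y\<close>
  are eventually reached after the centred time and levels above \<open>y\<close> before it.\<close>

lemma h_T_tendsto:
  assumes y: "q0 < y" "y < 1"
  shows "(\<lambda>n. h n (T (limit.U y) n)) \<longlonglongrightarrow> y"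
proof (rule order_tendstoI)
  let ?T = "T (limit.U y)"
  fix a assume "a < y"
  then obtain x where x: "max a q0 < x" "x < y" using dense[of "max a q0" y] y by auto
  have "0 < (limit.U x - limit.U y) / (m1 - 1)"
    using limit.U_strict_antimono[of x y] x y m1_gt by simp
  from order_tendstoD(1)[OF W_minus_T_tendsto this] x y
  have "eventually (\<lambda>n. 0 < W n x - ?T n) sequentially" by simp
  with T_nonneg_eventually[of "limit.U y"] show "eventually (\<lambda>n. a < h n (?T n)) sequentially"
  proof eventually_elim
    case (elim n)
    then show ?case using h_gt_level[of "?T n" x n] x y by simp
  qed
next
  let ?T = "T (limit.U y)"
  fix a assume "y < a"
  then obtain x where x: "y < x" "x < min a 1" using dense[of y "min a 1"] y by auto
  have "(limit.U x - limit.U y) / (m1 - 1) < 0"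
    using limit.U_strict_antimono[of y x] x y m1_gt by (simp add: divide_neg_pos)
  from order_tendstoD(2)[OF W_minus_T_tendsto this] x y
  have "eventually (\<lambda>n. W n x - ?T n < 0) sequentially" by simp
  moreover have "eventually (\<lambda>n. q n < x) sequentially"
    using order_tendstoD(2)[OF q_tendsto, of x] x y by simp
  ultimately show "eventually (\<lambda>n. h n (?T n) < a) sequentially" using T_nonneg_eventually[of "limit.U y"]
  proof eventually_elim
    case (elim n)
    then show ?case using h_less_level[of "?T n" n x] x by simp
  qed
qed

lemma supercritical_limit:
  "(\<lambda>n. (1 - h n (T u n)) / (1 - q n)) \<longlonglongrightarrow> cdf limit.limit_law u"
proof -
  obtain y where y: "q0 < y" "y < 1" "limit.U y = u" by (rule limit.U_surj)
  have "(\<lambda>n. (1 - h n (T u n)) / (1 - q n)) \<longlonglongrightarrow> (1 - y) / (1 - q0)"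
    using h_T_tendsto[OF y(1,2)] limit.q unfolding y(3) by (intro tendsto_intros q_tendsto) auto
  then show ?thesis using limit.cdf_limit_law[OF y(1,2)] unfolding y(3) by simp
qed

end

section \<open>Families of branching processes\<close>

text \<open>A slope above \<open>1\<close> puts \<open>f\<close> below the diagonal just left of
  \<open>1\<close>, while \<open>f(0) \<ge> 0\<close>. On the reals, \<open>LEAST\<close> is
  meaningful only once a minimum is exhibited.\<close>

lemma gen_fun_root_exists:
  assumes f: "\<And>k. 0 \<le> f k" "summable (\<lambda>k. f k * R ^ k)" "1 < R" "gen_fun f 1 = 1"
    and "1 < gen_fun (diffs f) 1"
  obtains q where "0 \<le> q" "q < 1" "gen_fun f q = q"
proof -
  have "((\<lambda>x. gen_fun f x - x) has_real_derivative gen_fun (diffs f) 1 - 1) (at 1)"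
    by (intro derivative_intros gen_fun_DERIV[OF f(2)]) (use f in auto)
  from DERIV_pos_inc_left[OF this] assms(5)
  obtain d where d: "0 < d" "\<And>h. 0 < h \<Longrightarrow> h < d \<Longrightarrow> gen_fun f (1 - h) - (1 - h) < gen_fun f 1 - 1"
    by auto
  define x where "x = 1 - min (1 / 2) (d / 2)"
  have x: "0 \<le> x" "x < 1" "gen_fun f x - x < 0"
    using d(1) d(2)[of "min (1 / 2) (d / 2)"] f(4) by (auto simp: x_def min_def)
  have "continuous_on {0..x} (\<lambda>x. gen_fun f x - x)"
    by (intro continuous_intros gen_fun_continuous_on[OF f(2)]) (use x f in auto)
  moreover have "0 \<le> gen_fun f 0 - 0"
    using gen_fun_nonneg[OF f(1), where x = 0] gen_fun_summable_le[OF f(1,2), where x = 0] f(3) by simp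
  ultimately obtain q where "0 \<le> q" "q \<le> x" "gen_fun f q - q = 0"
    using IVT2'[of "\<lambda>x. gen_fun f x - x" x 0 0] x by auto
  then show ?thesis using that[of q] x by auto
qed

text \<open>A smaller fixed point would itself satisfy the locale, and \<open>f\<close> would be
  strictly below the diagonal to its right, in particular at \<open>q\<close>.\<close>

lemma (in supercritical_gen_fun) Least_fixpoint: "(LEAST x. 0 \<le> x \<and> gen_fun_fixpoint f x) = q"
proof (rule Least_equality)
  show "0 \<le> q \<and> gen_fun_fixpoint f q"
    using q R gen_fun_summable_le[OF f, of q] by (simp add: gen_fun_fixpoint_eq)
  fix x assume x: "0 \<le> x \<and> gen_fun_fixpoint f x"
  show "q \<le> x"
  proof (rule ccontr)
    assume "\<not> ?thesis"
    then have less: "x < q" by simp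
    have "supercritical_gen_fun f R x"
      by (rule supercritical_gen_fun.intro[OF f R f_1 _ _ _ supercritical])
         (use x less q(2) in \<open>simp_all add: gen_fun_fixpoint_eq\<close>)
    from supercritical_gen_fun.f_less_id[OF this less q(2)] show False using q(3) by simp
  qed
qed

locale branching_family =
  fixes M :: "real \<Rightarrow> 'a measure"
    and p :: "real \<Rightarrow> nat \<Rightarrow> real"
    and L :: "real \<Rightarrow> nat list \<Rightarrow> 'a \<Rightarrow> real"
    and N :: "real \<Rightarrow> nat list \<Rightarrow> 'a \<Rightarrow> nat option"
    and q r :: "real \<Rightarrow> real"
    and f :: "nat \<Rightarrow> real"
    and \<epsilon>0 s0 :: real
  assumes \<epsilon>0: "0 < \<epsilon>0"
    and process: "\<And>\<epsilon>. 0 < \<epsilon> \<Longrightarrow> \<epsilon> < \<epsilon>0 \<Longrightarrow> branching_process (M \<epsilon>) (p \<epsilon>) (L \<epsilon>) (N \<epsilon>)"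
    and ext: "\<And>\<epsilon>. 0 < \<epsilon> \<Longrightarrow> \<epsilon> < \<epsilon>0 \<Longrightarrow> extendable (p \<epsilon>) (q \<epsilon>) (r \<epsilon>)"
    and defect: "\<And>\<epsilon>. 0 < \<epsilon> \<Longrightarrow> \<epsilon> < \<epsilon>0 \<Longrightarrow> \<epsilon> = 1 - gen_fun (p \<epsilon>) 1"
    and s0: "1 < s0"
    and f_nonneg: "\<And>k. 0 \<le> f k" and f_1: "gen_fun f 1 = 1" and f_summable: "summable (\<lambda>k. f k * s0 ^ k)"
    and p_tendsto: "\<And>s. s \<in> {0..s0} \<Longrightarrow>
           ((\<lambda>\<epsilon>. \<Sum>k. ennreal (p \<epsilon> k * s ^ k)) \<longlongrightarrow> ennreal (gen_fun f s)) (at_right 0)"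
begin

text \<open>The extended sums at \<open>s0\<close> have a finite limit, hence are finite for small
  parameters, where they are values of convergent series.\<close>

lemma eventually_summable:
  obtains \<epsilon>1 where "0 < \<epsilon>1" "\<epsilon>1 \<le> \<epsilon>0" "\<And>\<epsilon>. 0 < \<epsilon> \<Longrightarrow> \<epsilon> < \<epsilon>1 \<Longrightarrow> summable (\<lambda>k. p \<epsilon> k * s0 ^ k)"
proof -
  have "eventually (\<lambda>\<epsilon>. (\<Sum>k. ennreal (p \<epsilon> k * s0 ^ k)) < \<top>) (at_right 0)"
    by (rule order_tendstoD(2)[OF p_tendsto]) (use s0 in auto)
  then obtain b where b: "0 < b" "\<And>\<epsilon>. 0 < \<epsilon> \<Longrightarrow> \<epsilon> < b \<Longrightarrow> (\<Sum>k. ennreal (p \<epsilon> k * s0 ^ k)) < \<top>"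
    unfolding eventually_at_right_field by blast
  show ?thesis
  proof (rule that[of "min b \<epsilon>0"])
    fix \<epsilon> assume "0 < \<epsilon>" "\<epsilon> < min b \<epsilon>0"
    then have e: "0 < \<epsilon>" "\<epsilon> < b" "\<epsilon> < \<epsilon>0" by auto
    show "summable (\<lambda>k. p \<epsilon> k * s0 ^ k)"
    proof (rule summable_suminf_not_top)
      show "0 \<le> p \<epsilon> k * s0 ^ k" for k
        using branching_process.offspring_nonneg[OF process[OF e(1,3)], of k] s0 by simp
      show "(\<Sum>k. ennreal (p \<epsilon> k * s0 ^ k)) \<noteq> \<top>"
        using b(2)[OF e(1,2)] by (rule less_imp_neq)
    qed
  qed (use b \<epsilon>0 in auto)
qed

text \<open>A positive defect excludes \<open>1\<close> as a fixed point, which makes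
  \<open>q \<epsilon> \<le> 1 \<le> r \<epsilon>\<close> strict on both sides.\<close>

lemma extendable_facts:
  assumes "0 < \<epsilon>" "\<epsilon> < \<epsilon>0"
  shows "0 \<le> q \<epsilon>" "q \<epsilon> < 1" "gen_fun (p \<epsilon>) (q \<epsilon>) = q \<epsilon>"
    "1 < r \<epsilon>" "summable (\<lambda>k. p \<epsilon> k * r \<epsilon> ^ k)" "gen_fun (p \<epsilon>) (r \<epsilon>) = r \<epsilon>" "suminf (p \<epsilon>) < 1"
proof -
  have "gen_fun (p \<epsilon>) 1 < 1" using defect[OF assms] assms by simp
  then show "0 \<le> q \<epsilon>" "q \<epsilon> < 1" "gen_fun (p \<epsilon>) (q \<epsilon>) = q \<epsilon>"
    "1 < r \<epsilon>" "summable (\<lambda>k. p \<epsilon> k * r \<epsilon> ^ k)" "gen_fun (p \<epsilon>) (r \<epsilon>) = r \<epsilon>" "suminf (p \<epsilon>) < 1"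
    using ext[OF assms]
    by (auto simp: extendable_def gen_fun_fixpoint_eq gen_fun_def less_le)
qed

definition h :: "real \<Rightarrow> real \<Rightarrow> real" where
  "h \<epsilon> = branching_process.non_absorption (M \<epsilon>) (L \<epsilon>) (N \<epsilon>)"

lemma cond_prob_eq:
  assumes "0 < \<epsilon>" "\<epsilon> < \<epsilon>0" "0 \<le> t"
  shows "cond_prob (M \<epsilon>) (\<lambda>\<omega>. termination_time (L \<epsilon>) (N \<epsilon>) \<omega> \<le> ereal t)
      (\<lambda>\<omega>. termination_time (L \<epsilon>) (N \<epsilon>) \<omega> < \<infinity>) = (1 - h \<epsilon> t) / (1 - q \<epsilon>)"
proof -
  interpret branching_process "M \<epsilon>" "p \<epsilon>" "L \<epsilon>" "N \<epsilon>" by (rule process) fact+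
  note e = extendable_facts[OF assms(1,2)]
  show ?thesis unfolding h_def by (rule cond_prob_termination_time[OF e(4,5,7,1,2,3) assms(3)])
qed

lemma offspring_sequence:
  assumes S: "\<And>n. 0 < S n" "\<And>n. S n < \<epsilon>0" "S \<longlonglongrightarrow> 0" "\<And>n. summable (\<lambda>k. p (S n) k * s0 ^ k)"
  shows "offspring_sequence (\<lambda>n. p (S n)) f s0 (\<lambda>n. q (S n)) (\<lambda>n. r (S n)) (\<lambda>n. h (S n))"
proof
  fix n :: nat
  interpret branching_process "M (S n)" "p (S n)" "L (S n)" "N (S n)" by (rule process) fact+
  note e = extendable_facts[OF S(1,2), of n]
  show "0 \<le> p (S n) k" for k by (rule offspring_nonneg)
  show "gen_fun (p (S n)) 1 < 1" using defect[OF S(1,2), of n] S(1)[of n] by simp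
  show "0 \<le> q (S n)" "q (S n) < 1" "gen_fun (p (S n)) (q (S n)) = q (S n)"
    "1 < r (S n)" "summable (\<lambda>k. p (S n) k * r (S n) ^ k)" "gen_fun (p (S n)) (r (S n)) = r (S n)"
    by (fact e)+
  show "h (S n) 0 = 1" unfolding h_def by (rule non_absorption_0)
  show "q (S n) < h (S n) t" if "0 \<le> t" for t
    unfolding h_def by (rule non_absorption_gt[OF e(4,5,7,1,2,3) that])
  show "h (S n) t \<le> 1" for t unfolding h_def by (rule non_absorption_bounds)
  show "h (S n) t \<le> h (S n) s" if "s \<le> t" for s t unfolding h_def by (rule non_absorption_mono[OF that])
  show "(h (S n) has_real_derivative gen_fun (p (S n)) (h (S n) t) - h (S n) t) (at t within {0..b})" if "t \<in> {0..b}" for t b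
    unfolding h_def by (rule non_absorption_ODE[OF e(4,5) that])
next
  fix s assume s: "0 \<le> s" "s \<le> s0"
  have nn: "0 \<le> p (S n) k" for n k
    using branching_process.offspring_nonneg[OF process[OF S(1,2)]] .
  have sm: "summable (\<lambda>k. p (S n) k * s ^ k)" for n
    using gen_fun_summable_le[OF nn S(4) s] .
  have "filterlim S (at_right 0) sequentially"
    using S(1,3) S(1)[THEN less_imp_neq, symmetric] by (auto simp: filterlim_at intro!: always_eventually)
  from filterlim_compose[OF p_tendsto this] s
  have "(\<lambda>n. \<Sum>k. ennreal (p (S n) k * s ^ k)) \<longlonglongrightarrow> ennreal (gen_fun f s)" by simp
  moreover have "(\<Sum>k. ennreal (p (S n) k * s ^ k)) = ennreal (gen_fun (p (S n)) s)" for n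
    unfolding gen_fun_def by (rule suminf_ennreal2[OF _ sm]) (use nn s in simp)
  ultimately have "(\<lambda>n. ennreal (gen_fun (p (S n)) s)) \<longlonglongrightarrow> ennreal (gen_fun f s)" by simp
  then show "(\<lambda>n. gen_fun (p (S n)) s) \<longlonglongrightarrow> gen_fun f s"
    by (rule tendsto_ennrealD)
      (auto intro!: always_eventually gen_fun_nonneg nn sm s f_nonneg gen_fun_summable_le[OF f_nonneg f_summable])
qed (use s0 f_nonneg f_summable f_1 S in auto)

lemma tendsto_at_right_0I:
  assumes "\<And>S. (\<And>n. 0 < S n) \<Longrightarrow> (\<And>n. S n < \<epsilon>0) \<Longrightarrow> S \<longlonglongrightarrow> 0 \<Longrightarrow>
      offspring_sequence (\<lambda>n. p (S n)) f s0 (\<lambda>n. q (S n)) (\<lambda>n. r (S n)) (\<lambda>n. h (S n)) \<Longrightarrow>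
      (\<lambda>n. X (S n)) \<longlonglongrightarrow> l"
  shows "(X \<longlongrightarrow> l) (at_right 0)"
proof -
  obtain \<epsilon>1 where e: "0 < \<epsilon>1" "\<epsilon>1 \<le> \<epsilon>0" "\<And>\<epsilon>. 0 < \<epsilon> \<Longrightarrow> \<epsilon> < \<epsilon>1 \<Longrightarrow> summable (\<lambda>k. p \<epsilon> k * s0 ^ k)"
    by (rule eventually_summable) blast
  show ?thesis
  proof (rule tendsto_at_right_sequentially[OF e(1)])
    fix S :: "nat \<Rightarrow> real" assume S: "\<And>n. 0 < S n" "\<And>n. S n < \<epsilon>1" "decseq S" "S \<longlonglongrightarrow> 0"
    then have "S n < \<epsilon>0" for n using e(2) less_le_trans[of "S n" \<epsilon>1 \<epsilon>0] by simp
    with S e(3) show "(\<lambda>n. X (S n)) \<longlonglongrightarrow> l" by (intro assms offspring_sequence) auto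
  qed
qed

lemma subcritical_limit:
  assumes "gen_fun (diffs f) 1 < 1" "0 \<le> t"
  shows "((\<lambda>\<epsilon>. cond_prob (M \<epsilon>) (\<lambda>\<omega>. termination_time (L \<epsilon>) (N \<epsilon>) \<omega> \<le> ereal t)
      (\<lambda>\<omega>. termination_time (L \<epsilon>) (N \<epsilon>) \<omega> < \<infinity>))
    \<longlongrightarrow> 1 - exp (- (1 - gen_fun (diffs f) 1) * t)) (at_right 0)"
proof (rule tendsto_at_right_0I)
  fix S assume S: "\<And>n. 0 < S n" "\<And>n. S n < \<epsilon>0"
    and "offspring_sequence (\<lambda>n. p (S n)) f s0 (\<lambda>n. q (S n)) (\<lambda>n. r (S n)) (\<lambda>n. h (S n))"
  then interpret offspring_sequence "\<lambda>n. p (S n)" f s0 "\<lambda>n. q (S n)" "\<lambda>n. r (S n)" "\<lambda>n. h (S n)" by simp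
  show "(\<lambda>n. cond_prob (M (S n)) (\<lambda>\<omega>. termination_time (L (S n)) (N (S n)) \<omega> \<le> ereal t)
      (\<lambda>\<omega>. termination_time (L (S n)) (N (S n)) \<omega> < \<infinity>)) \<longlonglongrightarrow> 1 - exp (- (1 - gen_fun (diffs f) 1) * t)"
    unfolding cond_prob_eq[OF S assms(2)] by (rule subcritical_limit[OF assms])
qed

lemma supercritical_limit:
  assumes "supercritical_gen_fun f s0 q0"
  shows "((\<lambda>\<epsilon>. cond_prob (M \<epsilon>) (\<lambda>\<omega>. termination_time (L \<epsilon>) (N \<epsilon>) \<omega>
        \<le> ereal (ln (inverse (r \<epsilon> - 1)) / (deriv (gen_fun (p \<epsilon>)) (r \<epsilon>) - 1) + (ln (1 - q0) + u) / (gen_fun (diffs f) 1 - 1)))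
      (\<lambda>\<omega>. termination_time (L \<epsilon>) (N \<epsilon>) \<omega> < \<infinity>))
    \<longlongrightarrow> cdf (supercritical_gen_fun.limit_law f q0) u) (at_right 0)"
proof (rule tendsto_at_right_0I)
  fix S assume S: "\<And>n. 0 < S n" "\<And>n. S n < \<epsilon>0"
    and seq: "offspring_sequence (\<lambda>n. p (S n)) f s0 (\<lambda>n. q (S n)) (\<lambda>n. r (S n)) (\<lambda>n. h (S n))"
  interpret supercritical_sequence "\<lambda>n. p (S n)" f s0 "\<lambda>n. q (S n)" "\<lambda>n. r (S n)" "\<lambda>n. h (S n)" q0
    using seq assms by (simp add: supercritical_sequence_def)
  have "eventually (\<lambda>n. (1 - h (S n) (T u n)) / (1 - q (S n)) =
      cond_prob (M (S n)) (\<lambda>\<omega>. termination_time (L (S n)) (N (S n)) \<omega>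
        \<le> ereal (ln (inverse (r (S n) - 1)) / (deriv (gen_fun (p (S n))) (r (S n)) - 1) + (ln (1 - q0) + u) / (gen_fun (diffs f) 1 - 1)))
      (\<lambda>\<omega>. termination_time (L (S n)) (N (S n)) \<omega> < \<infinity>)) sequentially"
    using T_nonneg_eventually[of u] order_tendstoD(2)[OF r_tendsto s0]
  proof eventually_elim
    case (elim n)
    \<comment> \<open>Term-by-term differentiation at \<open>r (S n)\<close> relies on
      \<open>r (S n) < s0\<close>, which holds for large \<open>n\<close>.\<close>
    have "deriv (gen_fun (p (S n))) (r (S n)) - 1 = \<beta> n"
      unfolding \<beta>_def using elim(2) r(1)[of n] by (simp add: DERIV_imp_deriv[OF gen_fun_DERIV[OF P_summable]])
    then show ?case using cond_prob_eq[OF S elim(1)] by (simp add: T_def)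
  qed
  with supercritical_limit[of u]
  show "(\<lambda>n. cond_prob (M (S n)) (\<lambda>\<omega>. termination_time (L (S n)) (N (S n)) \<omega>
        \<le> ereal (ln (inverse (r (S n) - 1)) / (deriv (gen_fun (p (S n))) (r (S n)) - 1) + (ln (1 - q0) + u) / (gen_fun (diffs f) 1 - 1)))
      (\<lambda>\<omega>. termination_time (L (S n)) (N (S n)) \<omega> < \<infinity>)) \<longlonglongrightarrow> cdf (supercritical_gen_fun.limit_law f q0) u"
    by (rule Lim_transform_eventually)
qed

end

text \<open>The level \<open>y\<close> with \<open>U y = u\<close> is
  \<open>1 - (1 - q) * cdf limit_law u\<close>, so the equation is the definition of
  \<open>U\<close> read at \<open>y\<close>.\<close>

lemma (in supercritical_gen_fun) limit_law_equation:
  shows "0 < cdf limit_law u" "cdf limit_law u < 1"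
    "\<psi> integrable_on {1 - (1 - q) * cdf limit_law u..1}"
    "u = ln (cdf limit_law u) + integral {1 - (1 - q) * cdf limit_law u..1} \<psi>"
proof -
  obtain y where y: "q < y" "y < 1" "U y = u" by (rule U_surj)
  have cdf: "cdf limit_law u = (1 - y) / (1 - q)" using cdf_limit_law[OF y(1,2)] y(3) by simp
  then have eq: "1 - (1 - q) * cdf limit_law u = y" using q by simp
  show "0 < cdf limit_law u" "cdf limit_law u < 1" using y q by (auto simp: cdf)
  show "\<psi> integrable_on {1 - (1 - q) * cdf limit_law u..1}"
    unfolding eq by (rule \<psi>_integrable_on[OF y(1)])
  show "u = ln (cdf limit_law u) + integral {1 - (1 - q) * cdf limit_law u..1} \<psi>"
    unfolding eq unfolding cdf using y(3) unfolding U_def by (rule sym)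
qed

theorem theorem19:
  fixes M :: "real \<Rightarrow> 'a measure"
    and p :: "real \<Rightarrow> nat \<Rightarrow> real"
    and L :: "real \<Rightarrow> nat list \<Rightarrow> 'a \<Rightarrow> real"
    and N :: "real \<Rightarrow> nat list \<Rightarrow> 'a \<Rightarrow> nat option"
    and q\<epsilon> r\<epsilon> :: "real \<Rightarrow> real"
    and f :: "nat \<Rightarrow> real"
    and \<epsilon>0 s0 :: real
  assumes "0 < \<epsilon>0"
    and "\<And>\<epsilon>. 0 < \<epsilon> \<Longrightarrow> \<epsilon> < \<epsilon>0 \<Longrightarrow> branching_process (M \<epsilon>) (p \<epsilon>) (L \<epsilon>) (N \<epsilon>)"
    and "\<And>\<epsilon>. 0 < \<epsilon> \<Longrightarrow> \<epsilon> < \<epsilon>0 \<Longrightarrow> extendable (p \<epsilon>) (q\<epsilon> \<epsilon>) (r\<epsilon> \<epsilon>)"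
    and "\<And>\<epsilon>. 0 < \<epsilon> \<Longrightarrow> \<epsilon> < \<epsilon>0 \<Longrightarrow> \<epsilon> = 1 - gen_fun (p \<epsilon>) 1"
    and "1 < s0"
    and "\<And>k. 0 \<le> f k"
    and "gen_fun f 1 = 1"
    and "summable (\<lambda>k. f k * s0 ^ k)"
    and "gen_fun f s0 \<noteq> s0"
    \<comment> \<open>convergence in \<open>[0,\<infinity>]\<close>: \<open>p \<epsilon>\<close> may have an infinite generating function at \<open>s\<close>\<close>
    and "\<And>s. s \<in> {0..s0} \<Longrightarrow>
           ((\<lambda>\<epsilon>. \<Sum>k. ennreal (p \<epsilon> k * s ^ k)) \<longlongrightarrow> ennreal (gen_fun f s)) (at_right 0)"
  shows
    "let m1 = deriv (gen_fun f) 1;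
         T1 = (\<lambda>\<epsilon>. termination_time (L \<epsilon>) (N \<epsilon>))
     in
       (m1 < 1 \<longrightarrow>
          (\<forall>t\<ge>0. ((\<lambda>\<epsilon>. cond_prob (M \<epsilon>) (\<lambda>\<omega>. T1 \<epsilon> \<omega> \<le> ereal t) (\<lambda>\<omega>. T1 \<epsilon> \<omega> < \<infinity>))
                    \<longlongrightarrow> 1 - exp (- (1 - m1) * t)) (at_right 0)))
     \<and> (m1 > 1 \<longrightarrow>
          (let q = (LEAST x. 0 \<le> x \<and> gen_fun_fixpoint f x);
               \<beta> = (\<lambda>\<epsilon>. deriv (gen_fun (p \<epsilon>)) (r\<epsilon> \<epsilon>) - 1);
               \<phi> = (\<lambda>x. tail_gen_fun f [q, 1, x]);
               \<phi>2 = (\<lambda>x. tail_gen_fun f [q, 1, 1, x]);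
               \<psi> = (\<lambda>x. \<phi>2 x / \<phi> x + (m1 - 1) / ((1 - q) * (x - q) * \<phi> x))
           in
             q \<in> {0..<1} \<and> gen_fun_fixpoint f q
           \<and> (\<forall>x\<in>{q<..1}. \<psi> x > 0)
           \<and> (\<exists>D. real_distribution D
                \<and> (\<forall>u::real.
                     ((\<lambda>\<epsilon>. cond_prob (M \<epsilon>)
                              (\<lambda>\<omega>. T1 \<epsilon> \<omega> \<le> ereal (ln (inverse (r\<epsilon> \<epsilon> - 1)) / \<beta> \<epsilon>
                                                     + (ln (1 - q) + u) / (m1 - 1)))
                              (\<lambda>\<omega>. T1 \<epsilon> \<omega> < \<infinity>))
                        \<longlongrightarrow> cdf D u) (at_right 0)
                   \<and> 0 < cdf D u \<and> cdf D u < 1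
                   \<and> \<psi> integrable_on {1 - (1 - q) * cdf D u..1}
                   \<and> u = ln (cdf D u) + integral {1 - (1 - q) * cdf D u..1} \<psi>))))"
proof -
  interpret branching_family M p L N q\<epsilon> r\<epsilon> f \<epsilon>0 s0
    by (rule branching_family.intro[OF assms(1-8,10)])
  define m1 where "m1 = gen_fun (diffs f) 1"
  have deriv: "deriv (gen_fun f) 1 = m1"
    unfolding m1_def by (rule DERIV_imp_deriv[OF gen_fun_DERIV[OF f_summable]]) (use s0 in auto)
  define q where "q = (LEAST x. 0 \<le> x \<and> gen_fun_fixpoint f x)"
  have super: "supercritical_gen_fun f s0 q" if m1: "1 < m1"
  proof -
    \<comment> \<open>The locale is entered with some root; \<open>Least_fixpoint\<close> then
      identifies it with \<open>q\<close>.\<close>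
    obtain q0 where q0: "0 \<le> q0" "q0 < 1" "gen_fun f q0 = q0"
      by (rule gen_fun_root_exists[OF f_nonneg f_summable s0 f_1 m1[unfolded m1_def]])
    then interpret supercritical_gen_fun f s0 q0
      by (rule supercritical_gen_fun.intro[OF f_nonneg f_summable s0 f_1 _ _ _ m1[unfolded m1_def]])
    show ?thesis unfolding q_def Least_fixpoint by unfold_locales
  qed
  have props: "q \<in> {0..<1} \<and> gen_fun_fixpoint f q" if "1 < m1"
  proof -
    interpret supercritical_gen_fun f s0 q by (rule super[OF that])
    show ?thesis using q R gen_fun_summable_le[OF f, of q] by (simp add: gen_fun_fixpoint_eq)
  qed
  have \<psi>_eq: "supercritical_gen_fun.\<psi> f q = (\<lambda>x. tail_gen_fun f [q, 1, 1, x] / tail_gen_fun f [q, 1, x]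
      + (m1 - 1) / ((1 - q) * (x - q) * tail_gen_fun f [q, 1, x]))" if "1 < m1"
    using supercritical_gen_fun.\<psi>_def[OF super[OF that]] by (auto simp: m1_def)
  show ?thesis
    unfolding Let_def deriv q_def[symmetric]
  proof (intro conjI impI)
    assume "m1 < 1"
    then show "\<forall>t\<ge>0. ((\<lambda>\<epsilon>. cond_prob (M \<epsilon>) (\<lambda>\<omega>. termination_time (L \<epsilon>) (N \<epsilon>) \<omega> \<le> ereal t)
        (\<lambda>\<omega>. termination_time (L \<epsilon>) (N \<epsilon>) \<omega> < \<infinity>)) \<longlongrightarrow> 1 - exp (- (1 - m1) * t)) (at_right 0)"
      by (intro allI impI subcritical_limit[folded m1_def])
  next
    assume m1: "1 < m1"
    show "q \<in> {0..<1}" "gen_fun_fixpoint f q" using props[OF m1] by auto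
    note limit = super[OF m1]
    show "\<forall>x\<in>{q<..1}. 0 < tail_gen_fun f [q, 1, 1, x] / tail_gen_fun f [q, 1, x]
        + (m1 - 1) / ((1 - q) * (x - q) * tail_gen_fun f [q, 1, x])"
      using supercritical_gen_fun.\<psi>_pos[OF limit] unfolding \<psi>_eq[OF m1] by auto
    show "\<exists>D. real_distribution D \<and> (\<forall>u.
        ((\<lambda>\<epsilon>. cond_prob (M \<epsilon>) (\<lambda>\<omega>. termination_time (L \<epsilon>) (N \<epsilon>) \<omega>
            \<le> ereal (ln (inverse (r\<epsilon> \<epsilon> - 1)) / (deriv (gen_fun (p \<epsilon>)) (r\<epsilon> \<epsilon>) - 1) + (ln (1 - q) + u) / (m1 - 1)))
          (\<lambda>\<omega>. termination_time (L \<epsilon>) (N \<epsilon>) \<omega> < \<infinity>)) \<longlongrightarrow> cdf D u) (at_right 0)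
        \<and> 0 < cdf D u \<and> cdf D u < 1
        \<and> (\<lambda>x. tail_gen_fun f [q, 1, 1, x] / tail_gen_fun f [q, 1, x]
            + (m1 - 1) / ((1 - q) * (x - q) * tail_gen_fun f [q, 1, x])) integrable_on {1 - (1 - q) * cdf D u..1}
        \<and> u = ln (cdf D u) + integral {1 - (1 - q) * cdf D u..1} (\<lambda>x. tail_gen_fun f [q, 1, 1, x] / tail_gen_fun f [q, 1, x]
            + (m1 - 1) / ((1 - q) * (x - q) * tail_gen_fun f [q, 1, x])))"
      unfolding \<psi>_eq[OF m1, symmetric]
      by (intro exI[of _ "supercritical_gen_fun.limit_law f q"] conjI allI
          supercritical_gen_fun.real_distribution_limit_law[OF limit]
          supercritical_limit[OF limit, folded m1_def]
          supercritical_gen_fun.limit_law_equation[OF limit])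
  qed
qed

end
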